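(* Assume that $\mu \colon \mathcal{P}^2_o \to \mathbb{R}^2$ is a measurable valuation which is $\mathrm{VL}(2)$-covariant, i.e. $\mu(\phi P) = \phi\,\mu(P)$ for all $P \in \mathcal{P}^2_o$ and all $\phi \in \mathrm{VL}(2)$. Then there exists $k \in \mathbb{R}$ such that $\mu(P) = k\, m(P)$ for all $P \in \mathcal{P}^2_o$.
   Context: $\mathcal{P}^2_o$ denotes the set of convex polygons in $\mathbb{R}^2$ containing the origin in their interiors, with the Hausdorff metric topology; "measurable" refers to Borel $\sigma$-algebras. $\mathrm{VL}(2)$ is the group of linear maps of $\mathbb{R}^2$ with determinant $1$ or $-1$. A map $\mu$ on a family $\mathcal{S}$ of sets is a valuation if $\mu(K \cup L) + \mu(K \cap L) = \mu(K) + \mu(L)$ whenever $K, L, K\cup L, K \cap L \in \mathcal{S}$. The moment vector is $m(P) = \int_P x\,dx$. *)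

theory Defs
  imports "HOL-Analysis.Analysis"
begin

type_synonym pt = "real^2"

definition polygons_o :: "pt set set" where
  "polygons_o = {P. (\<exists>S. finite S \<and> P = convex hull S) \<and> (0::pt) \<in> interior P}"

definition hausdorff_dist :: "pt set \<Rightarrow> pt set \<Rightarrow> real" where
  "hausdorff_dist A B = max (SUP a\<in>A. infdist a B) (SUP b\<in>B. infdist b A)"

definition hausdorff_open_sets :: "pt set set set" where
  "hausdorff_open_sets = {U. U \<subseteq> polygons_o \<and>
     (\<forall>P\<in>U. \<exists>e>0. \<forall>Q\<in>polygons_o. hausdorff_dist P Q < e \<longrightarrow> Q \<in> U)}"

definition polygons_o_borel :: "pt set measure" where
  "polygons_o_borel = sigma polygons_o hausdorff_open_sets"

definition is_valuation :: "pt set set \<Rightarrow> (pt set \<Rightarrow> pt) \<Rightarrow> bool" where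
  "is_valuation \<S> \<mu> \<longleftrightarrow> (\<forall>K\<in>\<S>. \<forall>L\<in>\<S>. K \<union> L \<in> \<S> \<longrightarrow> K \<inter> L \<in> \<S> \<longrightarrow>
      \<mu> (K \<union> L) + \<mu> (K \<inter> L) = \<mu> K + \<mu> L)"

definition VL2 :: "(real^2^2) set" where
  "VL2 = {A. det A = 1 \<or> det A = -1}"

definition moment_vector :: "pt set \<Rightarrow> pt" where
  "moment_vector P = integral P (\<lambda>x. x)"

end

theory Submission
  imports Defs
begin

text \<open>
  If two polygons have the same section with a line through the origin, their halves can be
  exchanged without changing the sum of the values of \<open>\<mu>\<close>, as long as the results stay convex.
  Hence on quadrilaterals with a diagonal through the origin \<open>\<mu>\<close> splits into contributions of the
  two halves, and covariance expresses these by a single function \<open>f\<close> of one variable, up to a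
  cocycle of the shear group that reflections reduce to an additive function \<open>\<psi>\<close>.
  A triangle is a degenerate quadrilateral of this kind for each of its three vertices;
  comparing these descriptions gives a functional equation for \<open>f\<close> and \<open>\<psi>\<close>. Measurability makes \<open>\<psi>\<close>
  linear (with wild additive functions there are further solutions), and then
  \<open>f x = k (x\<^sup>2 - 1)\<close>. The moment vector satisfies the same hypotheses with \<open>k \<noteq> 0\<close>, so a multiple
  of it can be subtracted to achieve \<open>f = 0\<close>. Then \<open>\<mu>\<close> vanishes on all these quadrilaterals, and
  cutting a polygon along lines through the origin and its vertices shows that \<open>\<mu>\<close> vanishes.
\<close>

section \<open>Polygons and exchange of halves\<close>

text \<open>A half cut off by a line through the origin has the origin on its boundary, so \<mu> has
  no value on it. This obstacle shapes the proof: the contribution of a half is visible only by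
  comparing polygons that share the other half, and each half must receive a cap beyond the cut
  before the valuation property applies.

  Triangles with two equal determinants suffice to solve the equation. Once \<psi> is linear, its
  term depends only on a shape parameter \<theta> and not on the size of the triangle. Comparing
  \<theta> with 1 - \<theta> eliminates one value of \<open>f\<close> and leaves f (l z) = l^2 f z +
  f l; symmetry in l and z then fixes \<open>f\<close> up to a factor. Conversely
  \<open>f = 0\<close> forces \<psi> = 0, so subtracting a multiple of the moment vector removes
  both functions at once.

  In the final cutting, the cut goes through a vertex farthest from the base, so that the pieces are
  of the same kind with fewer vertices.\<close>

abbreviation pnt :: "real \<Rightarrow> real \<Rightarrow> pt" where
  "pnt x y \<equiv> vector [x, y]"

abbreviation mat2 :: "real \<Rightarrow> real \<Rightarrow> real \<Rightarrow> real \<Rightarrow> real^2^2" where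
  "mat2 a b c d \<equiv> vector [vector [a, b], vector [c, d]]"

lemma pt_eq_iff: "(u::pt) = v \<longleftrightarrow> u$1 = v$1 \<and> u$2 = v$2"
  by (simp add: vec_eq_iff forall_2)

lemma mat2_mult: "mat2 a b c d *v v = pnt (a * v$1 + b * v$2) (c * v$1 + d * v$2)"
  by (simp add: pt_eq_iff matrix_vector_mult_def sum_2)

lemma mat2_in_VL2: "mat2 a b c d \<in> VL2 \<longleftrightarrow> \<bar>a * d - b * c\<bar> = 1"
  by (auto simp: VL2_def det_2)

lemma inner_pt: "(u::pt) \<bullet> v = u$1 * v$1 + u$2 * v$2"
  by (simp add: inner_vec_def sum_2)

lemma polygons_o_altdef: "P \<in> polygons_o \<longleftrightarrow> polytope P \<and> 0 \<in> interior P"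
  by (simp add: polygons_o_def polytope_def)

lemma polygons_o_Int: "P \<in> polygons_o \<Longrightarrow> Q \<in> polygons_o \<Longrightarrow> P \<inter> Q \<in> polygons_o"
  by (simp add: polygons_o_altdef polytope_Int)

lemma polygons_o_convex: "P \<in> polygons_o \<Longrightarrow> convex P"
  by (simp add: polygons_o_altdef polytope_imp_convex)

text \<open>Were 0 not interior, a separating functional would be nonnegative on the interior and
  hence on its closure, which contains \<open>P\<close> once the interior is nonempty. An empty
  interior would put \<open>P\<close> into a hyperplane through 0.\<close>

lemma zero_in_interior_convex:
  fixes P :: "'a::euclidean_space set"
  assumes "convex P" and neg: "\<And>a. a \<noteq> 0 \<Longrightarrow> \<exists>x\<in>P. a \<bullet> x < 0"
  shows "0 \<in> interior P"
proof (rule ccontr)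
  assume 0: "0 \<notin> interior P"
  have "0 \<in> P"
    using separating_hyperplane_set_0[OF \<open>convex P\<close>] neg by (meson not_less)
  have ne: "interior P \<noteq> {}"
  proof
    assume "interior P = {}"
    then obtain a b where ab: "a \<noteq> 0" "P \<subseteq> {x. a \<bullet> x = b}"
      using empty_interior_subset_hyperplane[OF \<open>convex P\<close>] by metis
    with \<open>0 \<in> P\<close> have "b = 0" by auto
    with ab neg[of a] show False by auto
  qed
  obtain a where a: "a \<noteq> 0" "\<forall>x\<in>interior P. 0 \<le> a \<bullet> x"
    using separating_hyperplane_set_0[of "interior P"] 0 \<open>convex P\<close> by (auto simp: convex_interior)
  have "closure (interior P) \<subseteq> {x. 0 \<le> a \<bullet> x}"
    using a(2) by (intro closure_minimal) (auto simp: closed_halfspace_ge)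
  then have "P \<subseteq> {x. 0 \<le> a \<bullet> x}"
    using convex_closure_interior[OF \<open>convex P\<close> ne] closure_subset[of P] by auto
  then show False using neg[OF a(1)] by force
qed

lemma polygons_o_imageI:
  assumes "P \<in> polygons_o" and "A \<in> VL2"
  shows "(\<lambda>x. A *v x) ` P \<in> polygons_o"
proof -
  have "det A \<noteq> 0" using assms(2) by (auto simp: VL2_def)
  then have inv: "invertible A" by (simp add: invertible_det_nz)
  then have "inj ((*v) A)"
    by (metis inj_matrix_vector_mult)
  then have "interior ((*v) A ` P) = (*v) A ` interior P"
    by (intro interior_injective_linear_image) auto
  moreover have "0 \<in> (*v) A ` interior P"
    using assms(1) by (auto simp: polygons_o_altdef intro!: rev_image_eqI[of 0])
  moreover have "polytope ((*v) A ` P)"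
    using assms(1) by (intro polytope_linear_image) (auto simp: polygons_o_altdef)
  ultimately show ?thesis by (auto simp: polygons_o_altdef)
qed

text \<open>A segment from one piece to the other crosses the hyperplane in a point of
  \<open>P\<close>, which belongs to both pieces; so each part of the segment stays inside one
  piece.\<close>

lemma convex_union_across_line:
  fixes h :: "'a::euclidean_space \<Rightarrow> real"
  assumes "linear h" "convex A" "convex B" "convex P" "A \<subseteq> P" "B \<subseteq> P"
    and "\<And>x. x \<in> A \<Longrightarrow> h x \<ge> c" "\<And>x. x \<in> B \<Longrightarrow> h x \<le> c"
    and sec: "\<And>x. x \<in> P \<Longrightarrow> h x = c \<Longrightarrow> x \<in> A \<inter> B"
  shows "convex (A \<union> B)"
proof -
  have cross: "closed_segment p q \<subseteq> A \<union> B" if p: "p \<in> A" and q: "q \<in> B" for p q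
  proof -
    have "\<exists>r\<in>closed_segment p q. h r = c"
    proof (cases "h p = c")
      case False
      then have hp: "h p > c" using assms(7)[OF p] by simp
      have hq: "h q \<le> c" using assms(8)[OF q] .
      define t where "t = (h p - c) / (h p - h q)"
      have "h ((1 - t) *\<^sub>R p + t *\<^sub>R q) = (1 - t) * h p + t * h q"
        by (simp only: linear_add[OF \<open>linear h\<close>] linear_scale[OF \<open>linear h\<close>] real_scaleR_def)
      also have "\<dots> = h p - t * (h p - h q)" by (simp add: algebra_simps)
      also have "\<dots> = c" using hp hq unfolding t_def by simp
      finally have "h ((1 - t) *\<^sub>R p + t *\<^sub>R q) = c" .
      moreover have "0 \<le> t" "t \<le> 1" using hp hq by (auto simp: t_def)
      ultimately show ?thesis by (auto simp: closed_segment_def)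
    qed auto
    then obtain r where r: "r \<in> closed_segment p q" "h r = c" by blast
    have "closed_segment p q \<subseteq> P"
      using p q assms(4,5,6) by (meson closed_segment_subset subsetD)
    with r sec have "r \<in> A" "r \<in> B" by auto
    then have "closed_segment p r \<subseteq> A" "closed_segment r q \<subseteq> B"
      using p q assms(2,3) by (meson closed_segment_subset)+
    moreover have "closed_segment p q = closed_segment p r \<union> closed_segment r q"
      using r(1) by (simp add: Un_closed_segment)
    ultimately show ?thesis by auto
  qed
  show ?thesis
    unfolding convex_contains_segment
  proof (intro ballI)
    fix p q assume "p \<in> A \<union> B" "q \<in> A \<union> B"
    then show "closed_segment p q \<subseteq> A \<union> B"
      using cross[of p q] cross[of q p] assms(2,3)
      by (auto simp: closed_segment_commute dest: closed_segment_subset)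
  qed
qed

lemma linear_sign_convex_hull:
  fixes h :: "'a::real_vector \<Rightarrow> real"
  assumes "linear h"
  shows "(\<And>x. x \<in> S \<Longrightarrow> h x \<ge> c) \<Longrightarrow> x \<in> convex hull S \<Longrightarrow> h x \<ge> c"
    and "(\<And>x. x \<in> S \<Longrightarrow> h x \<le> c) \<Longrightarrow> x \<in> convex hull S \<Longrightarrow> h x \<le> c"
proof -
  have cv: "convex (h -` {c..})" "convex (h -` {..c})"
    by (intro convex_linear_vimage assms; simp)+
  show "h x \<ge> c" if "\<And>x. x \<in> S \<Longrightarrow> h x \<ge> c" "x \<in> convex hull S"
    using hull_minimal[of S "h -` {c..}" convex] cv that by auto
  show "h x \<le> c" if "\<And>x. x \<in> S \<Longrightarrow> h x \<le> c" "x \<in> convex hull S"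
    using hull_minimal[of S "h -` {..c}" convex] cv that by auto
qed

text \<open>Every splitting of a hull into two halves below rests on this: \<open>C\<close> spans
  the section with the line, \<open>A\<close> and \<open>B\<close> hold the vertices on its two
  sides.\<close>

lemma convex_hull_split_across_line:
  fixes h :: "'a::euclidean_space \<Rightarrow> real"
  assumes "linear h"
    and A: "\<And>x. x \<in> A \<Longrightarrow> h x \<ge> c" and B: "\<And>x. x \<in> B \<Longrightarrow> h x \<le> c"
    and C: "\<And>x. x \<in> C \<Longrightarrow> h x = c"
    and sec: "\<And>x. x \<in> convex hull (A \<union> B \<union> C) \<Longrightarrow> h x = c \<Longrightarrow> x \<in> convex hull C"
  shows "convex hull (A \<union> B \<union> C) = convex hull (A \<union> C) \<union> convex hull (B \<union> C)"
proof
  have sub: "convex hull (A \<union> C) \<subseteq> convex hull (A \<union> B \<union> C)"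
    "convex hull (B \<union> C) \<subseteq> convex hull (A \<union> B \<union> C)"
    "convex hull C \<subseteq> convex hull (A \<union> C)" "convex hull C \<subseteq> convex hull (B \<union> C)"
    by (intro hull_mono; blast)+
  then show "convex hull (A \<union> C) \<union> convex hull (B \<union> C) \<subseteq> convex hull (A \<union> B \<union> C)"
    by simp
  have "convex (convex hull (A \<union> C) \<union> convex hull (B \<union> C))"
  proof (rule convex_union_across_line[OF \<open>linear h\<close> convex_convex_hull convex_convex_hull
        convex_convex_hull sub(1,2)])
    show "h x \<ge> c" if "x \<in> convex hull (A \<union> C)" for x
      using linear_sign_convex_hull(1)[OF \<open>linear h\<close>, of "A \<union> C" c x] that A C by force
    show "h x \<le> c" if "x \<in> convex hull (B \<union> C)" for x
      using linear_sign_convex_hull(2)[OF \<open>linear h\<close>, of "B \<union> C" c x] that B C by force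
  qed (use sec sub in blast)
  moreover have "A \<union> B \<union> C \<subseteq> convex hull (A \<union> C) \<union> convex hull (B \<union> C)"
    using hull_subset[of "A \<union> C" convex] hull_subset[of "B \<union> C" convex] by blast
  ultimately show "convex hull (A \<union> B \<union> C) \<subseteq> convex hull (A \<union> C) \<union> convex hull (B \<union> C)"
    by (rule hull_minimal[rotated])
qed

locale covariant_valuation =
  fixes \<mu> :: "pt set \<Rightarrow> pt"
  assumes valuation: "is_valuation polygons_o \<mu>"
    and covariant: "\<And>P A. P \<in> polygons_o \<Longrightarrow> A \<in> VL2 \<Longrightarrow> \<mu> ((\<lambda>x. A *v x) ` P) = A *v \<mu> P"
begin

lemma valuationD:
  "\<lbrakk>K \<in> polygons_o; L \<in> polygons_o; K \<union> L \<in> polygons_o\<rbrakk> \<Longrightarrow> \<mu> (K \<union> L) + \<mu> (K \<inter> L) = \<mu> K + \<mu> L"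
  using valuation polygons_o_Int unfolding is_valuation_def by blast

text \<open>One instance of the valuation property: the two mixed polygons have union
  \<open>A \<union> B\<close>, and their intersection is \<open>A0 \<union> B0\<close> because the
  points of \<open>A \<inter> B\<close> are already in \<open>A0\<close>.\<close>

lemma exchange_nested:
  assumes "A0 \<subseteq> A" "B0 \<subseteq> B" "A \<inter> B \<subseteq> A0"
    and "A \<union> B \<in> polygons_o" "A \<union> B0 \<in> polygons_o" "A0 \<union> B \<in> polygons_o"
  shows "\<mu> (A \<union> B) + \<mu> (A0 \<union> B0) = \<mu> (A \<union> B0) + \<mu> (A0 \<union> B)"
proof -
  have "(A \<union> B0) \<union> (A0 \<union> B) = A \<union> B" "(A \<union> B0) \<inter> (A0 \<union> B) = A0 \<union> B0"
    using assms(1-3) by auto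
  then show ?thesis using valuationD[of "A \<union> B0" "A0 \<union> B"] assms by simp
qed

text \<open>Passing to the common intersections of the two upper and of the two lower parts reduces
  this to the nested case.\<close>

lemma exchange:
  assumes I: "A1 \<inter> B1 = I" "A1 \<inter> B2 = I" "A2 \<inter> B1 = I" "A2 \<inter> B2 = I"
    and P: "A1 \<union> B1 \<in> polygons_o" "A1 \<union> B2 \<in> polygons_o"
      "A2 \<union> B1 \<in> polygons_o" "A2 \<union> B2 \<in> polygons_o"
  shows "\<mu> (A1 \<union> B1) + \<mu> (A2 \<union> B2) = \<mu> (A1 \<union> B2) + \<mu> (A2 \<union> B1)"
proof -
  define A B where "A = A1 \<inter> A2" and "B = B1 \<inter> B2"
  have "A1 \<union> B = (A1 \<union> B1) \<inter> (A1 \<union> B2)" "A2 \<union> B = (A2 \<union> B1) \<inter> (A2 \<union> B2)"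
    "A \<union> B1 = (A1 \<union> B1) \<inter> (A2 \<union> B1)" "A \<union> B2 = (A1 \<union> B2) \<inter> (A2 \<union> B2)"
    unfolding A_def B_def by auto
  then have Q: "A1 \<union> B \<in> polygons_o" "A2 \<union> B \<in> polygons_o"
    "A \<union> B1 \<in> polygons_o" "A \<union> B2 \<in> polygons_o"
    using P polygons_o_Int by auto
  have sub: "A \<subseteq> A1" "A \<subseteq> A2" "B \<subseteq> B1" "B \<subseteq> B2" "I \<subseteq> A"
    using I unfolding A_def B_def by auto
  have "\<mu> (A1 \<union> B1) + \<mu> (A \<union> B) = \<mu> (A1 \<union> B) + \<mu> (A \<union> B1)"
    "\<mu> (A1 \<union> B2) + \<mu> (A \<union> B) = \<mu> (A1 \<union> B) + \<mu> (A \<union> B2)"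
    "\<mu> (A2 \<union> B1) + \<mu> (A \<union> B) = \<mu> (A2 \<union> B) + \<mu> (A \<union> B1)"
    "\<mu> (A2 \<union> B2) + \<mu> (A \<union> B) = \<mu> (A2 \<union> B) + \<mu> (A \<union> B2)"
    using P Q sub I by (intro exchange_nested; simp)+
  then show ?thesis by (auto simp: pt_eq_iff)
qed

end

section \<open>The functional equation\<close>

text \<open>The set where the function is bounded by a large \<open>n\<close> fills more than three quarters of the
  unit interval, so it meets each of its translates by less than \<open>1/2\<close>.\<close>

lemma additive_measurable_bounded:
  fixes \<psi> :: "real \<Rightarrow> real"
  assumes add: "\<And>x y. \<psi> (x + y) = \<psi> x + \<psi> y" and meas: "\<psi> \<in> borel_measurable borel"
  shows "\<exists>C. \<forall>x. \<bar>x\<bar> < 1/2 \<longrightarrow> \<bar>\<psi> x\<bar> \<le> C"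
proof -
  define A where "A n = {x \<in> {0..1}. \<bar>\<psi> x\<bar> \<le> real n}" for n
  have A_sets: "A n \<in> sets lebesgue" for n
  proof -
    have "A n \<in> sets borel"
      using meas unfolding A_def by measurable
    then show ?thesis by simp
  qed
  have A_lmeas: "A n \<in> lmeasurable" for n
    by (rule bounded_set_imp_lmeasurable[OF _ A_sets])
      (rule bounded_subset[of "{0..1}"], auto simp: A_def)
  have "(\<Union>n. A n) = {0..1}"
    unfolding A_def by (auto intro: real_arch_simple)
  moreover have "(\<lambda>n. measure lebesgue (A n)) \<longlonglongrightarrow> measure lebesgue (\<Union>n. A n)"
  proof (rule Lim_measure_incseq)
    show "incseq A" unfolding A_def by (auto simp: incseq_def)
    show "emeasure lebesgue (\<Union>n. A n) \<noteq> \<infinity>"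
      unfolding \<open>(\<Union>n. A n) = {0..1}\<close> by simp
  qed (use A_sets in auto)
  ultimately have "(\<lambda>n. measure lebesgue (A n)) \<longlonglongrightarrow> 1" by simp
  then have "eventually (\<lambda>n. measure lebesgue (A n) > 3/4) sequentially"
    by (rule order_tendstoD) simp
  then obtain n where n: "measure lebesgue (A n) > 3/4"
    by (auto simp: eventually_sequentially)
  have "\<bar>\<psi> x\<bar> \<le> 2 * real n" if x: "\<bar>x\<bar> < 1/2" for x
  proof -
    have "\<exists>y\<in>A n. x + y \<in> A n"
    proof (rule ccontr)
      assume no: "\<not> (\<exists>y\<in>A n. x + y \<in> A n)"
      have tr: "(+) x ` A n \<in> lmeasurable" using A_lmeas by (simp add: measurable_translation)
      have "measure lebesgue (A n \<union> (+) x ` A n)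
          = measure lebesgue (A n) + measure lebesgue ((+) x ` A n)"
      proof -
        have "A n \<inter> (+) x ` A n = {}" using no by auto
        then show ?thesis using measure_Un3[OF A_lmeas tr] by simp
      qed
      moreover have "measure lebesgue (A n \<union> (+) x ` A n) \<le> measure lebesgue {min 0 x..max 1 (1 + x)}"
        using A_lmeas tr by (intro measure_mono_fmeasurable) (auto simp: A_def fmeasurableD)
      ultimately show False
        using n x by (auto simp: measure_translation min_def max_def split: if_splits)
    qed
    then obtain y where "y \<in> A n" "x + y \<in> A n" by blast
    then show ?thesis using add[of x y] by (auto simp: A_def)
  qed
  then show ?thesis by blast
qed

text \<open>The deviation \<open>g\<close> from linearity vanishes at the integers, hence is
  periodic; the bound near 0 then holds globally, and a bounded additive function is 0.\<close>

lemma additive_measurable_linear: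
  fixes \<psi> :: "real \<Rightarrow> real"
  assumes add: "\<And>x y. \<psi> (x + y) = \<psi> x + \<psi> y" and meas: "\<psi> \<in> borel_measurable borel"
  shows "\<psi> x = x * \<psi> 1"
proof -
  obtain C where C: "\<And>x. \<bar>x\<bar> < 1/2 \<Longrightarrow> \<bar>\<psi> x\<bar> \<le> C"
    using additive_measurable_bounded[OF assms] by blast
  interpret additive \<psi> by standard (rule add)
  define g where "g x = \<psi> x - x * \<psi> 1" for x
  have g_add: "g (x + y) = g x + g y" for x y by (simp add: g_def add algebra_simps)
  interpret g: additive g by standard (rule g_add)
  have g_nat: "g (real n * x) = real n * g x" for n x
    by (induction n) (auto simp: g.zero g_add algebra_simps)
  have g1: "g 1 = 0" by (simp add: g_def)
  have g_int: "g (of_int k) = 0" for k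
    using g_nat[of "nat k" 1] g_nat[of "nat (-k)" 1] g.minus[of "of_int (- k)"] g1
    by (cases "k \<ge> 0") auto
  have "C \<ge> 0" using C[of 0] by simp
  have g_frac: "\<bar>g x\<bar> \<le> 2 * (C + \<bar>\<psi> 1\<bar>)" for x
  proof -
    \<comment> \<open>Halving moves the fractional part into the range below 1/2 where the bound
      \<open>C\<close> is available.\<close>
    define r where "r = frac x / 2"
    have r: "0 \<le> r" "r < 1/2" using frac_ge_0[of x] frac_lt_1[of x] by (auto simp: r_def)
    have "g x = g (of_int \<lfloor>x\<rfloor> + frac x)" by (simp add: frac_def)
    also have "\<dots> = 2 * g r"
      using g_nat[of 2 r] by (simp add: g_add g_int r_def)
    finally have "\<bar>g x\<bar> = 2 * \<bar>g r\<bar>" by simp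
    moreover have "\<bar>g r\<bar> \<le> \<bar>\<psi> r\<bar> + \<bar>r * \<psi> 1\<bar>" by (simp add: g_def)
    moreover have "\<bar>r * \<psi> 1\<bar> \<le> 1 * \<bar>\<psi> 1\<bar>"
      unfolding abs_mult using r by (intro mult_right_mono) auto
    ultimately show ?thesis using C[of r] r by simp
  qed
  have "g x = 0"
  proof (rule ccontr)
    assume "g x \<noteq> 0"
    then obtain n where "2 * (C + \<bar>\<psi> 1\<bar>) < real n * \<bar>g x\<bar>"
      using reals_Archimedean3[of "\<bar>g x\<bar>"] by auto
    then show False using g_frac[of "real n * x"] by (simp add: g_nat abs_mult)
  qed
  then show ?thesis by (simp add: g_def)
qed

text \<open>The equation states that \<open>\<mu>\<close> is compatible with a cyclic relabelling of the vertices of a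
  triangle \<open>[v\<^sub>1, v\<^sub>2, v\<^sub>3]\<close> around the origin; \<open>a\<close>, \<open>b\<close>, \<open>c\<close> are the determinants of \<open>(v\<^sub>2, v\<^sub>3)\<close>, \<open>(v\<^sub>3, v\<^sub>1)\<close>,
  \<open>(v\<^sub>1, v\<^sub>2)\<close>.\<close>

locale triangle_equation =
  fixes f :: "real \<Rightarrow> real" and \<psi> :: "real \<Rightarrow> real \<Rightarrow> real"
  assumes psi_add: "\<And>\<theta> s t. \<theta> > 0 \<Longrightarrow> \<psi> \<theta> (s + t) = \<psi> \<theta> s + \<psi> \<theta> t"
    and f_one: "f 1 = 0"
    and equation: "\<And>a b c. a > 0 \<Longrightarrow> b > 0 \<Longrightarrow> c > 0 \<Longrightarrow>
      (b + 2 * c) * f (a * b / (b + c)) + b * f (a * c / (b + c)) + (a - c) * f b - b * f a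
      + 2 * b * c * \<psi> (a / (b + c)) (a / (b * c))
      + (a + c) * (f (b * c / (a + c)) - f (a * b / (a + c))) = 0"
begin

text \<open>Without \<open>f\<close> only the \<psi> term of the equation survives. With
  \<open>c = b\<close> and \<open>a = 2 * \<theta> * b\<close>, its two arguments become \<theta>
  and \<open>2 * \<theta> / b\<close>, which is \<sigma> for the chosen \<open>b\<close>.\<close>

lemma psi_eq_zero:
  assumes f0: "\<And>x. x > 0 \<Longrightarrow> f x = 0" and "\<theta> > 0"
  shows "\<psi> \<theta> \<sigma> = 0"
proof -
  interpret additive "\<psi> \<theta>" by standard (rule psi_add[OF \<open>\<theta> > 0\<close>])
  have pos: "\<psi> \<theta> \<sigma> = 0" if "\<sigma> > 0" for \<sigma>
  proof -
    define b where "b = 2 * \<theta> / \<sigma>"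
    have b: "b > 0" using that \<open>\<theta> > 0\<close> by (simp add: b_def)
    have "2 * \<theta> * b / (b + b) = \<theta>" "2 * \<theta> * b / (b * b) = \<sigma>"
      using b that \<open>\<theta> > 0\<close> by (auto simp: b_def)
    moreover have "2 * \<theta> * b > 0" using b \<open>\<theta> > 0\<close> by simp
    moreover have "f (2 * \<theta> * b * b / (b + b)) = 0" "f b = 0" "f (2 * \<theta> * b) = 0"
      "f (b * b / (2 * \<theta> * b + b)) = 0" "f (2 * \<theta> * b * b / (2 * \<theta> * b + b)) = 0"
      using b \<open>\<theta> > 0\<close> by (intro f0; simp add: add_pos_pos)+
    ultimately have "2 * b * b * \<psi> \<theta> \<sigma> = 0"
      using equation[of "2 * \<theta> * b" b b] b by simp
    then show ?thesis using b by simp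
  qed
  show ?thesis
    using pos[of \<sigma>] pos[of "- \<sigma>"] minus[of \<sigma>] zero by (cases \<sigma> "0::real" rule: linorder_cases) auto
qed

text \<open>The case of two equal determinants, where the last difference and the term with
  \<open>a - c\<close> in \<open>equation\<close> drop out. The middle determinant \<open>b\<close>
  is chosen to make \<open>a / (b + a) = \<theta>\<close>.\<close>

lemma diagonal_equation:
  assumes \<theta>: "0 < \<theta>" "\<theta> < 1" and a: "a > 0"
  shows "(1 + \<theta>) * f ((1 - \<theta>) * a) + (1 - \<theta>) * (f (\<theta> * a) - f a)
    + 2 * (1 - \<theta>) * a * \<psi> \<theta> (\<theta> / ((1 - \<theta>) * a)) = 0"
proof -
  \<comment> \<open>Here \<open>c\<close> is the sum \<open>b + a\<close>, a common factor to be
    cancelled; the third determinant is \<open>a\<close>.\<close>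
  define c where "c = a / \<theta>"
  define b where "b = c * (1 - \<theta>)"
  have c: "c > 0" "a = c * \<theta>" and b: "b > 0" using \<theta> a by (auto simp: c_def b_def)
  have ab: "b + a = c" by (simp add: b_def c(2) algebra_simps)
  have e: "a * b / (b + a) = (1 - \<theta>) * a" "a * a / (b + a) = \<theta> * a"
    "b * a / (a + b) = (1 - \<theta>) * a" "a * b / (a + b) = (1 - \<theta>) * a"
    "a / (b + a) = \<theta>" "a / (b * a) = \<theta> / ((1 - \<theta>) * a)"
    using \<theta> c(1) by (simp_all only: ab add.commute[of a b]) (simp_all add: b_def c(2) field_simps)
  have "(b + 2 * a) * f ((1 - \<theta>) * a) + b * f (\<theta> * a) - b * f a
      + 2 * b * a * \<psi> \<theta> (\<theta> / ((1 - \<theta>) * a)) = 0"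
    using equation[OF a b a] unfolding e by simp
  moreover have "b + 2 * a = c * (1 + \<theta>)" "2 * b * a = c * (2 * (1 - \<theta>) * a)"
    using ab c(2) by (simp_all add: b_def algebra_simps)
  ultimately have "c * ((1 + \<theta>) * f ((1 - \<theta>) * a) + (1 - \<theta>) * (f (\<theta> * a) - f a)
      + 2 * (1 - \<theta>) * a * \<psi> \<theta> (\<theta> / ((1 - \<theta>) * a))) = 0"
    by (simp add: b_def algebra_simps)
  then show ?thesis using c(1) by (simp only: mult_eq_0_iff) simp
qed

text \<open>The diagonal equation can be solved for \<psi>, whose argument runs through all positive
  reals as \<open>a\<close> does. So \<psi> inherits measurability from \<open>f\<close>; oddness
  supplies the negative half-line.\<close>

lemma psi_linear:
  assumes meas: "(\<lambda>x. if x > 0 then f x else 0) \<in> borel_measurable borel" and \<theta>: "0 < \<theta>" "\<theta> < 1"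
  shows "\<psi> \<theta> \<sigma> = \<sigma> * \<psi> \<theta> 1"
proof (rule additive_measurable_linear[OF psi_add[OF \<theta>(1)]])
  interpret additive "\<psi> \<theta>" by standard (rule psi_add[OF \<theta>(1)])
  define F where "F x = (if x > 0 then f x else 0)" for x
  have [measurable]: "F \<in> borel_measurable borel" using meas unfolding F_def .
  \<comment> \<open>The inverse substitution: for this \<open>a\<close> the argument of \<psi> in
    the diagonal equation is \<sigma>.\<close>
  define a where "a \<sigma> = \<theta> / ((1 - \<theta>) * \<sigma>)" for \<sigma>
  have [measurable]: "a \<in> borel_measurable borel" unfolding a_def by measurable
  define g where "g \<sigma> = - ((1 + \<theta>) * F ((1 - \<theta>) * a \<sigma>) + (1 - \<theta>) * (F (\<theta> * a \<sigma>) - F (a \<sigma>)))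
    / (2 * (1 - \<theta>) * a \<sigma>)" for \<sigma>
  have [measurable]: "g \<in> borel_measurable borel" unfolding g_def by measurable
  have pos: "\<psi> \<theta> \<sigma> = g \<sigma>" if \<sigma>: "\<sigma> > 0" for \<sigma>
  proof -
    have a: "a \<sigma> > 0" using \<sigma> \<theta> by (simp add: a_def)
    have \<sigma>_eq: "\<theta> / ((1 - \<theta>) * a \<sigma>) = \<sigma>" using \<sigma> \<theta> by (simp add: a_def)
    have "2 * (1 - \<theta>) * a \<sigma> * \<psi> \<theta> \<sigma>
        = - ((1 + \<theta>) * f ((1 - \<theta>) * a \<sigma>) + (1 - \<theta>) * (f (\<theta> * a \<sigma>) - f (a \<sigma>)))"
      using diagonal_equation[OF \<theta> a] unfolding \<sigma>_eq by linarith
    moreover have "(1 - \<theta>) * a \<sigma> > 0" "\<theta> * a \<sigma> > 0" using a \<theta> by auto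
    moreover have "2 * (1 - \<theta>) * a \<sigma> \<noteq> 0" using a \<theta> by auto
    ultimately show ?thesis
      using a unfolding g_def F_def by (simp only: if_True eq_divide_eq) (simp add: mult_ac)
  qed
  have "\<psi> \<theta> = (\<lambda>\<sigma>. if \<sigma> > 0 then g \<sigma> else if \<sigma> < 0 then - g (- \<sigma>) else 0)"
  proof
    fix \<sigma> show "\<psi> \<theta> \<sigma> = (if \<sigma> > 0 then g \<sigma> else if \<sigma> < 0 then - g (- \<sigma>) else 0)"
      using pos[of \<sigma>] pos[of "- \<sigma>"] minus[of \<sigma>] zero
      by (cases \<sigma> "0::real" rule: linorder_cases) auto
  qed
  also have "\<dots> \<in> borel_measurable borel" by measurable
  finally show "\<psi> \<theta> \<in> borel_measurable borel" .
qed

lemma f_quadratic: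
  assumes meas: "(\<lambda>x. if x > 0 then f x else 0) \<in> borel_measurable borel"
  shows "\<exists>k. \<forall>x>0. f x = k * (x\<^sup>2 - 1)"
proof -
  \<comment> \<open>Linearity of \<psi> cancels the factor \<open>a\<close>, so the last term
    depends on \<theta> alone.\<close>
  have F1: "(1 + \<theta>) * f ((1 - \<theta>) * a) + (1 - \<theta>) * (f (\<theta> * a) - f a) + 2 * \<theta> * \<psi> \<theta> 1 = 0"
    if \<theta>: "0 < \<theta>" "\<theta> < 1" and a: "a > 0" for \<theta> a
  proof -
    have "2 * (1 - \<theta>) * a * \<psi> \<theta> (\<theta> / ((1 - \<theta>) * a)) = 2 * \<theta> * \<psi> \<theta> 1"
      using \<theta> a by (subst psi_linear[OF meas \<theta>]) (simp add: field_simps)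
    then show ?thesis using diagonal_equation[OF that] by simp
  qed
  have scale: "f (l * z) = l\<^sup>2 * f z + f l" if l: "l > 0" and z: "z > 0" for l z
  proof -
    \<comment> \<open>Chosen so that \<open>1 - \<theta>\<close> and \<theta> are in the ratio
      \<open>l\<close>.\<close>
    define \<theta> where "\<theta> = 1 / (1 + l)"
    have \<theta>: "0 < \<theta>" "\<theta> < 1" "1 - \<theta> = l * \<theta>" using l by (auto simp: \<theta>_def field_simps)
    define K where "K = (2 * (1 - \<theta>) * (1 - \<theta>) * \<psi> (1 - \<theta>) 1 - 2 * \<theta> * \<theta> * \<psi> \<theta> 1) / (2 * \<theta>\<^sup>2)"
    have *: "f (l * z) = l\<^sup>2 * f z + K" if z: "z > 0" for z
    proof -
      define a where "a = z / \<theta>"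
      have a: "a > 0" "\<theta> * a = z" "(1 - \<theta>) * a = l * z"
        using z \<theta> by (auto simp: a_def)
      have "(1 + \<theta>) * f (l * z) + (1 - \<theta>) * (f z - f a) + 2 * \<theta> * \<psi> \<theta> 1 = 0"
        using F1[OF \<theta>(1,2) a(1)] a by simp
      \<comment> \<open>Passing from \<theta> to \<open>1 - \<theta>\<close> at the same
        \<open>a\<close> swaps the arguments \<open>z\<close> and \<open>l * z\<close>; a
        combination of the two equations eliminates \<open>f a\<close>.\<close>
      moreover have "(2 - \<theta>) * f z + \<theta> * (f (l * z) - f a) + 2 * (1 - \<theta>) * \<psi> (1 - \<theta>) 1 = 0"
        using F1[of "1 - \<theta>" a] \<theta>(1,2) a(1) by (simp add: a(2,3))
      ultimately have "2 * \<theta>\<^sup>2 * f (l * z) = 2 * (1 - \<theta>)\<^sup>2 * f z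
          + (2 * (1 - \<theta>) * (1 - \<theta>) * \<psi> (1 - \<theta>) 1 - 2 * \<theta> * \<theta> * \<psi> \<theta> 1)"
        by algebra
      then have "2 * \<theta>\<^sup>2 * f (l * z) = 2 * \<theta>\<^sup>2 * (l\<^sup>2 * f z) + 2 * \<theta>\<^sup>2 * K"
        unfolding K_def using \<theta>(1) by (simp add: \<theta>(3) power_mult_distrib)
      then have "2 * \<theta>\<^sup>2 * f (l * z) = 2 * \<theta>\<^sup>2 * (l\<^sup>2 * f z + K)" by (simp add: algebra_simps)
      then show ?thesis using \<theta>(1) by simp
    qed
    show ?thesis using *[OF z] *[of 1] f_one by simp
  qed
  \<comment> \<open>Expanding \<open>f (2 * x)\<close> once with \<open>l = 2\<close> and once with
    \<open>l = x\<close> gives \<open>3 * f x = (x\<^sup>2 - 1) * f 2\<close>.\<close>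
  have "f x = f 2 / 3 * (x\<^sup>2 - 1)" if "x > 0" for x
    using scale[of 2 x] scale[of x 2] that by (simp add: mult.commute[of 2] field_simps)
  then show ?thesis by blast
qed

end

section \<open>Quadrilaterals with a diagonal through the origin\<close>

definition quad :: "real \<Rightarrow> real \<Rightarrow> pt \<Rightarrow> pt \<Rightarrow> pt set" where
  "quad x y u v = convex hull {pnt x 0, pnt (- y) 0, u, v}"

lemma quad_in_polygons_o:
  assumes "x > 0" "y > 0" "u$2 > 0" "v$2 < 0"
  shows "quad x y u v \<in> polygons_o"
  unfolding polygons_o_altdef
proof
  show "polytope (quad x y u v)"
    unfolding quad_def by (rule polytope_convex_hull) simp
  show "0 \<in> interior (quad x y u v)"
  proof (rule zero_in_interior_convex)
    show "convex (quad x y u v)" by (simp add: quad_def)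
    fix a :: pt assume "a \<noteq> 0"
    have V: "pnt x 0 \<in> quad x y u v" "pnt (- y) 0 \<in> quad x y u v" "u \<in> quad x y u v" "v \<in> quad x y u v"
      unfolding quad_def by (auto intro: hull_inc)
    consider "a$1 > 0" | "a$1 < 0" | "a$1 = 0" "a$2 > 0" | "a$1 = 0" "a$2 < 0"
      using \<open>a \<noteq> 0\<close> by (auto simp: pt_eq_iff) linarith+
    then show "\<exists>p\<in>quad x y u v. a \<bullet> p < 0"
    proof cases
      case 1 with V(2) assms show ?thesis by (intro bexI[of _ "pnt (- y) 0"]) (auto simp: inner_pt)
    next
      case 2 with V(1) assms show ?thesis
        by (intro bexI[of _ "pnt x 0"]) (auto simp: inner_pt mult_neg_pos)
    next
      case 3 with V(4) assms show ?thesis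
        by (intro bexI[of _ v]) (auto simp: inner_pt mult_pos_neg)
    next
      case 4 with V(3) assms show ?thesis
        by (intro bexI[of _ u]) (auto simp: inner_pt mult_neg_pos)
    qed
  qed
qed

lemma image_quad:
  "(\<lambda>p. A *v p) ` quad x y u v
    = convex hull {A *v pnt x 0, A *v pnt (- y) 0, A *v u, A *v v}"
  unfolding quad_def by (subst convex_hull_linear_image) auto

text \<open>\<sigma> and \<tau> are the inverse slopes of the lines from the origin to the upper and
  lower vertex. The signs are such that \<sigma> = \<tau> means that both vertices lie on one line
  through the origin, and a horizontal shear adds the same number to both.\<close>

definition kite :: "real \<Rightarrow> real \<Rightarrow> real \<Rightarrow> real \<Rightarrow> real \<Rightarrow> real \<Rightarrow> pt set" where
  "kite x y \<sigma> s \<tau> t = quad x y (pnt (\<sigma> * s) s) (pnt (- \<tau> * t) (- t))"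

text \<open>Equivalently, the section of the kite with the horizontal axis is the segment from \<open>(-y, 0)\<close> to
  \<open>(x, 0)\<close>; for equality in one of the bounds the kite degenerates to a triangle.\<close>

definition proper :: "real \<Rightarrow> real \<Rightarrow> real \<Rightarrow> real \<Rightarrow> real \<Rightarrow> real \<Rightarrow> bool" where
  "proper x y \<sigma> s \<tau> t \<longleftrightarrow> \<sigma> - \<tau> \<le> x * (1/s + 1/t) \<and> \<tau> - \<sigma> \<le> y * (1/s + 1/t)"

abbreviation tri :: "real \<Rightarrow> real \<Rightarrow> pt \<Rightarrow> pt set" where
  "tri x y u \<equiv> convex hull {pnt x 0, pnt (- y) 0, u}"

lemma segment_on_axis:
  assumes "p$2 = 0" "- y \<le> p$1" "p$1 \<le> x" "0 < x" "0 < y"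
  shows "p \<in> convex hull {pnt x 0, pnt (- y) 0}"
  unfolding convex_hull_2
proof (intro CollectI exI conjI)
  define k where "k = 1 / (x + y)"
  have k: "k * (x + y) = 1" "k > 0" using assms by (auto simp: k_def)
  have "p$1 = (p$1 + y) * k * x - (x - p$1) * k * y" using k(1) by algebra
  then show "p = ((p$1 + y) * k) *\<^sub>R pnt x 0 + ((x - p$1) * k) *\<^sub>R pnt (- y) 0"
    using assms by (simp add: pt_eq_iff)
  show "(p$1 + y) * k + (x - p$1) * k = 1" using k(1) by algebra
  show "0 \<le> (p$1 + y) * k" "0 \<le> (x - p$1) * k" using assms k(2) by auto
qed

lemma kite_in_polygons_o:
  "x > 0 \<Longrightarrow> y > 0 \<Longrightarrow> s > 0 \<Longrightarrow> t > 0 \<Longrightarrow> kite x y \<sigma> s \<tau> t \<in> polygons_o"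
  unfolding kite_def by (rule quad_in_polygons_o) auto

lemma linear_coord: "linear (\<lambda>p::pt. p$i)"
  by (auto intro!: linearI simp: algebra_simps)

text \<open>In a convex combination that lies on the axis, the weights \<open>a\<close> and
  \<open>b\<close> of the upper and lower vertex balance in height. By \<open>proper\<close> their
  joint first coordinate is then between \<open>- y * (a + b)\<close> and
  \<open>x * (a + b)\<close>, so the point stays in the segment.\<close>

lemma kite_split:
  assumes pos: "x > 0" "y > 0" "s > 0" "t > 0" and pr: "proper x y \<sigma> s \<tau> t"
  shows "kite x y \<sigma> s \<tau> t = tri x y (pnt (\<sigma> * s) s) \<union> tri x y (pnt (- \<tau> * t) (- t))"
proof -
  let ?u = "pnt (\<sigma> * s) s" and ?v = "pnt (- \<tau> * t) (- t)"
  have "convex hull ({?u} \<union> {?v} \<union> {pnt x 0, pnt (- y) 0})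
      = convex hull ({?u} \<union> {pnt x 0, pnt (- y) 0}) \<union> convex hull ({?v} \<union> {pnt x 0, pnt (- y) 0})"
  proof (rule convex_hull_split_across_line[where c = 0, OF linear_coord[of 2]])
    fix p assume p: "p \<in> convex hull ({?u} \<union> {?v} \<union> {pnt x 0, pnt (- y) 0})" and p2: "p$2 = 0"
    obtain a b c d where w: "a \<ge> 0" "b \<ge> 0" "c \<ge> 0" "d \<ge> 0" "a + b + c + d = 1"
      and pe: "p = a *\<^sub>R ?u + b *\<^sub>R ?v + c *\<^sub>R pnt x 0 + d *\<^sub>R pnt (- y) 0"
    proof -
      have "p \<in> convex hull (insert ?u (insert ?v {pnt x 0, pnt (- y) 0}))"
        using p by (simp only: Un_insert_left Un_empty_left)
      then obtain q k where k: "0 \<le> k" "k \<le> 1" "p = (1 - k) *\<^sub>R ?u + k *\<^sub>R q"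
        and "q \<in> convex hull (insert ?v {pnt x 0, pnt (- y) 0})"
        by (subst (asm) convex_hull_insert_alt) auto
      then obtain r l where l: "0 \<le> l" "l \<le> 1" "q = (1 - l) *\<^sub>R ?v + l *\<^sub>R r"
        and "r \<in> convex hull {pnt x 0, pnt (- y) 0}"
        by (subst (asm) convex_hull_insert_alt) auto
      then obtain m n where m: "0 \<le> m" "0 \<le> n" "m + n = 1" "r = m *\<^sub>R pnt x 0 + n *\<^sub>R pnt (- y) 0"
        by (auto simp: convex_hull_2)
      have "1 - k + k * (1 - l) + k * l * m + k * l * n = 1" using m(3) by algebra
      then show ?thesis
        using k l m by (intro that[of "1 - k" "k * (1 - l)" "k * l * m" "k * l * n"])
          (auto simp: scaleR_add_right mult.assoc add.assoc)
    qed
    have at: "a * s = b * t" using p2 by (simp add: pe)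
    have p1: "p$1 = a * s * (\<sigma> - \<tau>) + c * x - d * y"
      using at by (simp add: pe) algebra
    have S: "a * s * (1/s + 1/t) = a + b"
      using at pos by (simp add: field_simps)
    have as: "a * s \<ge> 0" using w pos by simp
    have "p$1 \<le> x"
    proof -
      have "0 \<le> x * d" "0 \<le> d * y" using w pos by auto
      have "a * s * (\<sigma> - \<tau>) \<le> a * s * (x * (1/s + 1/t))"
        using pr as unfolding proper_def by (intro mult_left_mono) auto
      also have "\<dots> = x * (a + b)" using S by algebra
      finally have "p$1 \<le> x * (a + b + c) - d * y" by (simp add: p1 algebra_simps)
      also have "a + b + c = 1 - d" using w(5) by simp
      also have "x * (1 - d) - d * y \<le> x"
        using \<open>0 \<le> x * d\<close> \<open>0 \<le> d * y\<close> by (simp add: right_diff_distrib)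
      finally show ?thesis by simp
    qed
    moreover have "- y \<le> p$1"
    proof -
      have "0 \<le> y * c" "0 \<le> c * x" using w pos by auto
      have "a * s * (\<tau> - \<sigma>) \<le> a * s * (y * (1/s + 1/t))"
        using pr as unfolding proper_def by (intro mult_left_mono) auto
      also have "\<dots> = y * (a + b)" using S by algebra
      finally have "- (p$1) \<le> y * (a + b + d) - c * x" by (simp add: p1 algebra_simps)
      also have "a + b + d = 1 - c" using w(5) by simp
      also have "y * (1 - c) - c * x \<le> y"
        using \<open>0 \<le> y * c\<close> \<open>0 \<le> c * x\<close> by (simp add: right_diff_distrib)
      finally show ?thesis by simp
    qed
    ultimately show "p \<in> convex hull {pnt x 0, pnt (- y) 0}"
      using p2 pos by (intro segment_on_axis) auto
  qed (use pos in auto)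
  moreover have "{?u} \<union> {?v} \<union> {pnt x 0, pnt (- y) 0} = {pnt x 0, pnt (- y) 0, ?u, ?v}"
    "{?u} \<union> {pnt x 0, pnt (- y) 0} = {pnt x 0, pnt (- y) 0, ?u}"
    "{?v} \<union> {pnt x 0, pnt (- y) 0} = {pnt x 0, pnt (- y) 0, ?v}" by auto
  ultimately show ?thesis by (simp only: quad_def kite_def)
qed

lemma tri_section:
  assumes "p \<in> tri x y u" "p$2 = 0" "u$2 \<noteq> 0"
  shows "p \<in> convex hull {pnt x 0, pnt (- y) 0}"
proof -
  have "p \<in> convex hull (insert u {pnt x 0, pnt (- y) 0})"
    using assms(1) by (simp add: insert_commute)
  then obtain a b where "0 \<le> a" "a \<le> 1" "b \<in> convex hull {pnt x 0, pnt (- y) 0}"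
    and pe: "p = (1 - a) *\<^sub>R u + a *\<^sub>R b"
    by (subst (asm) convex_hull_insert_alt) auto
  moreover have "b$2 = 0"
    using \<open>b \<in> _\<close> by (auto simp: convex_hull_2)
  ultimately show ?thesis using assms by simp
qed

lemma tri_Int_tri:
  assumes "u$2 > 0" "v$2 < 0"
  shows "tri x y u \<inter> tri x y v = convex hull {pnt x 0, pnt (- y) 0}"
proof
  show "tri x y u \<inter> tri x y v \<subseteq> convex hull {pnt x 0, pnt (- y) 0}"
  proof
    fix p assume p: "p \<in> tri x y u \<inter> tri x y v"
    have "p$2 \<ge> 0"
      by (rule linear_sign_convex_hull(1)[OF linear_coord[of 2], of "{pnt x 0, pnt (- y) 0, u}"])
        (use p assms in auto)
    moreover have "p$2 \<le> 0"
      by (rule linear_sign_convex_hull(2)[OF linear_coord[of 2], of "{pnt x 0, pnt (- y) 0, v}"])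
        (use p assms in auto)
    ultimately show "p \<in> convex hull {pnt x 0, pnt (- y) 0}"
      using p assms by (intro tri_section[of p x y u]) auto
  qed
  show "convex hull {pnt x 0, pnt (- y) 0} \<subseteq> tri x y u \<inter> tri x y v"
    by (auto intro: hull_mono[THEN subsetD, rotated])
qed

section \<open>Exchange and covariance for kites\<close>

context covariant_valuation
begin

lemma kite_exchange:
  assumes pos: "x > 0" "y > 0" "s > 0" "t > 0" "s' > 0" "t' > 0"
    and pr: "proper x y \<sigma> s \<tau> t" "proper x y \<sigma> s \<tau>' t'" "proper x y \<sigma>' s' \<tau> t" "proper x y \<sigma>' s' \<tau>' t'"
  shows "\<mu> (kite x y \<sigma> s \<tau> t) + \<mu> (kite x y \<sigma>' s' \<tau>' t')
    = \<mu> (kite x y \<sigma> s \<tau>' t') + \<mu> (kite x y \<sigma>' s' \<tau> t)"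
proof -
  have "kite x y \<sigma> s \<tau> t \<in> polygons_o" "kite x y \<sigma> s \<tau>' t' \<in> polygons_o"
    "kite x y \<sigma>' s' \<tau> t \<in> polygons_o" "kite x y \<sigma>' s' \<tau>' t' \<in> polygons_o"
    using pos by (auto intro!: kite_in_polygons_o)
  then show ?thesis
    using pos pr tri_Int_tri[of _ _ x y]
    by (simp only: kite_split) (intro exchange; simp)
qed

lemma mu_kite_image:
  assumes "x > 0" "y > 0" "s > 0" "t > 0" "A \<in> VL2"
    and "{A *v pnt x 0, A *v pnt (- y) 0, A *v pnt (\<sigma> * s) s, A *v pnt (- \<tau> * t) (- t)}
      = {pnt x' 0, pnt (- y') 0, pnt (\<sigma>' * s') s', pnt (- \<tau>' * t') (- t')}"
  shows "\<mu> (kite x' y' \<sigma>' s' \<tau>' t') = A *v \<mu> (kite x y \<sigma> s \<tau> t)"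
proof -
  have "(\<lambda>p. A *v p) ` kite x y \<sigma> s \<tau> t = kite x' y' \<sigma>' s' \<tau>' t'"
    unfolding kite_def image_quad assms(6) by (simp only: quad_def)
  then show ?thesis
    using covariant[OF kite_in_polygons_o assms(5), of x y s t \<sigma> \<tau>] assms by simp
qed

lemma mu_kite_shear:
  assumes "x > 0" "y > 0" "s > 0" "t > 0"
  shows "\<mu> (kite x y (\<sigma> + d) s (\<tau> + d) t) = mat2 1 d 0 1 *v \<mu> (kite x y \<sigma> s \<tau> t)"
  using assms by (intro mu_kite_image) (simp_all add: mat2_in_VL2 mat2_mult algebra_simps)

lemma mu_kite_reflect_vertical:
  assumes "x > 0" "y > 0" "s > 0" "t > 0"
  shows "\<mu> (kite x y (- \<tau>) t (- \<sigma>) s) = mat2 1 0 0 (-1) *v \<mu> (kite x y \<sigma> s \<tau> t)"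
  using assms by (intro mu_kite_image) (simp_all add: mat2_in_VL2 mat2_mult insert_commute)

lemma mu_kite_reflect_horizontal:
  assumes "x > 0" "y > 0" "s > 0" "t > 0"
  shows "\<mu> (kite y x 0 s 0 t) = mat2 (-1) 0 0 1 *v \<mu> (kite x y 0 s 0 t)"
  using assms by (intro mu_kite_image) (simp_all add: mat2_in_VL2 mat2_mult insert_commute)

lemma mu_kite_swap:
  assumes "x > 0" "y > 0" "s > 0" "t > 0"
  shows "\<mu> (kite s t 0 x 0 y) = mat2 0 1 1 0 *v \<mu> (kite x y 0 s 0 t)"
  using assms by (intro mu_kite_image) (auto simp: mat2_in_VL2 mat2_mult)

lemma mu_kite_stretch:
  assumes "x > 0" "y > 0" "s > 0" "t > 0" "r > 0"
  shows "\<mu> (kite (r * x) (r * y) 0 (s / r) 0 (t / r)) = mat2 r 0 0 (1/r) *v \<mu> (kite x y 0 s 0 t)"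
  using assms by (intro mu_kite_image) (simp_all add: mat2_in_VL2 mat2_mult)

text \<open>Reflection in the horizontal axis fixes this kite, so the second coordinate of \<mu> is
  0 and \<open>f\<close> is all of its value. All other upright kites are reduced to it.\<close>

definition f :: "real \<Rightarrow> real" where
  "f x = \<mu> (kite x 1 0 1 0 1) $ 1"

lemma proper_zero: "x > 0 \<Longrightarrow> y > 0 \<Longrightarrow> s > 0 \<Longrightarrow> t > 0 \<Longrightarrow> proper x y \<sigma> s \<sigma> t"
  by (simp add: proper_def)

lemma f_one: "f 1 = 0"
  using mu_kite_reflect_horizontal[of 1 1 1 1] by (simp add: f_def mat2_mult pt_eq_iff)

text \<open>Reflection in the diagonal turns \<open>x\<close> and \<open>y\<close> into heights over
  a common section, where they can be exchanged separately; a stretch reduces \<open>s\<close> to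
  1.\<close>

lemma kite_upright_same:
  assumes "x > 0" "y > 0" "s > 0"
  shows "\<mu> (kite x y 0 s 0 s) $ 1 = (f (s * x) - f (s * y)) / s"
proof -
  have *: "\<mu> (kite x y 0 1 0 1) $ 1 = f x - f y" if "x > 0" "y > 0" for x y
  proof -
    have "\<mu> (kite 1 1 0 x 0 y) + \<mu> (kite 1 1 0 1 0 1) = \<mu> (kite 1 1 0 x 0 1) + \<mu> (kite 1 1 0 1 0 y)"
      using that by (intro kite_exchange) (auto simp: proper_zero)
    then have "\<mu> (kite 1 1 0 x 0 y) $ 2 + \<mu> (kite 1 1 0 1 0 1) $ 2
        = \<mu> (kite 1 1 0 x 0 1) $ 2 + \<mu> (kite 1 1 0 1 0 y) $ 2"
      by (simp add: pt_eq_iff)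
    moreover have "\<mu> (kite 1 1 0 x 0 y) $ 2 = \<mu> (kite x y 0 1 0 1) $ 1" if "x > 0" "y > 0" for x y
      using mu_kite_swap[of x y 1 1] that by (simp add: mat2_mult pt_eq_iff)
    moreover have "\<mu> (kite 1 y 0 1 0 1) $ 1 = - f y"
      using mu_kite_reflect_horizontal[of y 1 1 1] that by (simp add: mat2_mult f_def)
    ultimately show ?thesis using that f_one by (simp add: f_def)
  qed
  have "\<mu> (kite (s * x) (s * y) 0 (s / s) 0 (s / s)) = mat2 s 0 0 (1/s) *v \<mu> (kite x y 0 s 0 s)"
    using assms by (intro mu_kite_stretch) auto
  then have "\<mu> (kite (s * x) (s * y) 0 1 0 1) $ 1 = s * \<mu> (kite x y 0 s 0 s) $ 1"
    using assms by (simp add: mat2_mult)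
  then show ?thesis using *[of "s * x" "s * y"] assms by (simp add: field_simps)
qed

text \<open>Exchanging halves turns the kites with heights \<open>(s, t)\<close> and
  \<open>(t, s)\<close> into those with heights \<open>(s, s)\<close> and \<open>(t, t)\<close>. The
  first two are mirror images with the same first coordinate, whence the factors 1/2.\<close>

lemma kite_upright_1:
  assumes "x > 0" "y > 0" "s > 0" "t > 0"
  shows "\<mu> (kite x y 0 s 0 t) $ 1 = (f (s * x) - f (s * y)) / (2 * s) + (f (t * x) - f (t * y)) / (2 * t)"
proof -
  have "\<mu> (kite x y 0 s 0 t) + \<mu> (kite x y 0 t 0 s) = \<mu> (kite x y 0 s 0 s) + \<mu> (kite x y 0 t 0 t)"
    using assms by (intro kite_exchange) (auto simp: proper_zero)
  then have "\<mu> (kite x y 0 s 0 t) $ 1 + \<mu> (kite x y 0 t 0 s) $ 1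
      = \<mu> (kite x y 0 s 0 s) $ 1 + \<mu> (kite x y 0 t 0 t) $ 1"
    by (simp add: pt_eq_iff)
  moreover have "\<mu> (kite x y 0 t 0 s) $ 1 = \<mu> (kite x y 0 s 0 t) $ 1"
    using mu_kite_reflect_vertical[of x y s t 0 0] assms by (simp add: mat2_mult)
  ultimately show ?thesis using assms by (simp add: kite_upright_same)
qed

lemma kite_upright_2:
  assumes "x > 0" "y > 0" "s > 0" "t > 0"
  shows "\<mu> (kite x y 0 s 0 t) $ 2 = (f (s * x) - f (t * x)) / (2 * x) + (f (s * y) - f (t * y)) / (2 * y)"
  using kite_upright_1[of s t x y] mu_kite_swap[of x y s t] assms
  by (simp add: mat2_mult mult.commute)

text \<open>\<open>V1\<close> and \<open>V2\<close> are the shares of an upper half with height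
  \<open>s\<close> over the segment from -1 to \<open>x\<close> in the two coordinates. For a lower
  half, reflection keeps the first share and negates the second, hence the signs in
  \<open>kite_same_slope\<close>.\<close>

definition V1 :: "real \<Rightarrow> real \<Rightarrow> real" where
  "V1 x s = (f (s * x) - f s) / (2 * s)"

definition V2 :: "real \<Rightarrow> real \<Rightarrow> real" where
  "V2 x s = f (s * x) / (2 * x) + f s / 2"

lemma kite_same_slope:
  assumes "x > 0" "s > 0" "t > 0"
  shows "\<mu> (kite x 1 \<sigma> s \<sigma> t) $ 1 = V1 x s + V1 x t + \<sigma> * (V2 x s - V2 x t)"
    and "\<mu> (kite x 1 \<sigma> s \<sigma> t) $ 2 = V2 x s - V2 x t"
  using mu_kite_shear[of x 1 s t 0 \<sigma> 0] assms
  by (simp_all add: mat2_mult kite_upright_1 kite_upright_2 V1_def V2_def diff_divide_distrib)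

text \<open>Reflection in the horizontal axis preserves the difference of the two slopes but negates the
  second coordinate.\<close>

lemma kite_equal_heights_2:
  assumes "x > 0" "e > 0"
  shows "\<mu> (kite x 1 \<sigma> e \<tau> e) $ 2 = 0"
proof -
  have "\<mu> (kite x 1 (- \<tau>) e (- \<sigma>) e) $ 2 = - \<mu> (kite x 1 \<sigma> e \<tau> e) $ 2"
    using assms by (subst mu_kite_reflect_vertical) (auto simp: mat2_mult)
  moreover have "\<mu> (kite x 1 (- \<tau> + (\<sigma> + \<tau>)) e (- \<sigma> + (\<sigma> + \<tau>)) e) $ 2 = \<mu> (kite x 1 (- \<tau>) e (- \<sigma>) e) $ 2"
    using assms by (subst mu_kite_shear) (auto simp: mat2_mult)
  ultimately show ?thesis by simp
qed

text \<open>The shear by \<tau> changes the first coordinate by \<tau> times the second, which is 0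
  at equal heights.\<close>

lemma kite_shift_1:
  assumes "x > 0" "e > 0"
  shows "\<mu> (kite x 1 \<sigma> e \<tau> e) $ 1 = \<mu> (kite x 1 (\<sigma> - \<tau>) e 0 e) $ 1"
  using mu_kite_shear[of x 1 e e "\<sigma> - \<tau>" \<tau> 0] kite_equal_heights_2[of x e "\<sigma> - \<tau>" 0] assms
  by (simp add: mat2_mult)

section \<open>Kites with two different slopes\<close>

lemma proper_small:
  assumes "x > 0" "e > 0" "e * \<bar>\<sigma> - \<tau>\<bar> \<le> 2 * min x 1"
  shows "proper x 1 \<sigma> e \<tau> e"
proof -
  have "\<bar>\<sigma> - \<tau>\<bar> \<le> min x 1 * (2 / e)" using assms by (simp add: field_simps)
  moreover have "min x 1 * (2 / e) \<le> x * (2 / e)" "min x 1 * (2 / e) \<le> 1 * (2 / e)"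
    using assms by (intro mult_right_mono; simp)+
  ultimately show ?thesis unfolding proper_def by auto
qed

text \<open>Exchange with a flat kite of height \<open>e\<close> whose slopes are interchanged
  produces two kites of equal slopes, whose values are known. The first coordinate of the flat kite
  depends only on the difference of the slopes.\<close>

lemma kite_reduce:
  assumes "x > 0" "s > 0" "t > 0" "e > 0" "proper x 1 \<sigma> s \<tau> t" "e * \<bar>\<sigma> - \<tau>\<bar> \<le> 2 * min x 1"
  shows "\<mu> (kite x 1 \<sigma> s \<tau> t) $ 1 = V1 x s + V1 x t + \<sigma> * V2 x s - \<tau> * V2 x t
      + (2 * V1 x e - (\<sigma> - \<tau>) * V2 x e - \<mu> (kite x 1 (\<tau> - \<sigma>) e 0 e) $ 1)"
    and "\<mu> (kite x 1 \<sigma> s \<tau> t) $ 2 = V2 x s - V2 x t"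
proof -
  have "\<mu> (kite x 1 \<sigma> s \<tau> t) + \<mu> (kite x 1 \<tau> e \<sigma> e) = \<mu> (kite x 1 \<sigma> s \<sigma> e) + \<mu> (kite x 1 \<tau> e \<tau> t)"
    using assms by (intro kite_exchange) (auto simp: proper_zero proper_small abs_minus_commute)
  then have *: "\<mu> (kite x 1 \<sigma> s \<tau> t) $ i
      = \<mu> (kite x 1 \<sigma> s \<sigma> e) $ i + \<mu> (kite x 1 \<tau> e \<tau> t) $ i - \<mu> (kite x 1 \<tau> e \<sigma> e) $ i" for i
    by (metis add_diff_cancel_right' vector_add_component)
  show "\<mu> (kite x 1 \<sigma> s \<tau> t) $ 1 = V1 x s + V1 x t + \<sigma> * V2 x s - \<tau> * V2 x t
      + (2 * V1 x e - (\<sigma> - \<tau>) * V2 x e - \<mu> (kite x 1 (\<tau> - \<sigma>) e 0 e) $ 1)"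
    using assms(1-4) unfolding *[of 1]
    by (subst kite_shift_1) (auto simp: kite_same_slope algebra_simps)
  show "\<mu> (kite x 1 \<sigma> s \<tau> t) $ 2 = V2 x s - V2 x t"
    using assms(1-4) unfolding *[of 2]
    by (simp add: kite_same_slope kite_equal_heights_2)
qed

text \<open>The value of \<open>e\<close> is only small enough to make the auxiliary kites proper; it does not matter
  otherwise.\<close>

definition \<psi> :: "real \<Rightarrow> real \<Rightarrow> real" where
  "\<psi> x d = (let e = 2 * min x 1 / (1 + \<bar>d\<bar>) in
     2 * V1 x e - d * V2 x e - \<mu> (kite x 1 (- d) e 0 e) $ 1)"

lemma kite_formula:
  assumes "x > 0" "s > 0" "t > 0" "proper x 1 \<sigma> s \<tau> t"
  shows "\<mu> (kite x 1 \<sigma> s \<tau> t) $ 1 = V1 x s + V1 x t + \<sigma> * V2 x s - \<tau> * V2 x t + \<psi> x (\<sigma> - \<tau>)"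
    and "\<mu> (kite x 1 \<sigma> s \<tau> t) $ 2 = V2 x s - V2 x t"
proof -
  define e where "e = 2 * min x 1 / (1 + \<bar>\<sigma> - \<tau>\<bar>)"
  have e: "e > 0" using assms by (auto simp: e_def intro!: divide_pos_pos)
  have "e * \<bar>\<sigma> - \<tau>\<bar> \<le> e * (1 + \<bar>\<sigma> - \<tau>\<bar>)" using e by (intro mult_left_mono) auto
  also have "\<dots> = 2 * min x 1" unfolding e_def by simp
  finally have le: "e * \<bar>\<sigma> - \<tau>\<bar> \<le> 2 * min x 1" .
  show "\<mu> (kite x 1 \<sigma> s \<tau> t) $ 2 = V2 x s - V2 x t"
    by (rule kite_reduce(2)[OF assms(1-3) e assms(4) le])
  show "\<mu> (kite x 1 \<sigma> s \<tau> t) $ 1 = V1 x s + V1 x t + \<sigma> * V2 x s - \<tau> * V2 x t + \<psi> x (\<sigma> - \<tau>)"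
    using kite_reduce(1)[OF assms(1-3) e assms(4) le] unfolding \<psi>_def Let_def e_def[symmetric]
    by simp
qed

text \<open>Exchange between the kites with slopes \<open>(d + d', d')\<close> and
  \<open>(d', 0)\<close> produces \<open>(d + d', 0)\<close> and \<open>(d', d')\<close>. At equal
  heights the shares of the halves cancel, and \<open>(d', d')\<close> carries no \<psi>. The height
  \<open>e\<close> makes all four kites proper.\<close>

lemma psi_add:
  assumes "x > 0"
  shows "\<psi> x (d + d') = \<psi> x d + \<psi> x d'"
proof -
  define e where "e = 2 * min x 1 / (1 + \<bar>d\<bar> + \<bar>d'\<bar>)"
  have e: "e > 0" using assms by (auto simp: e_def intro!: divide_pos_pos)
  have le: "e * \<bar>r\<bar> \<le> 2 * min x 1" if "\<bar>r\<bar> \<le> 1 + \<bar>d\<bar> + \<bar>d'\<bar>" for r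
  proof -
    have "e * \<bar>r\<bar> \<le> e * (1 + \<bar>d\<bar> + \<bar>d'\<bar>)" using e that by (intro mult_left_mono) auto
    also have "\<dots> = 2 * min x 1" unfolding e_def by simp
    finally show ?thesis .
  qed
  have pr: "proper x 1 (d + d') e d' e" "proper x 1 d' e 0 e" "proper x 1 (d + d') e 0 e"
    "proper x 1 d' e d' e"
    using assms e by (auto intro!: proper_small le)
  have "\<mu> (kite x 1 (d + d') e d' e) + \<mu> (kite x 1 d' e 0 e)
      = \<mu> (kite x 1 (d + d') e 0 e) + \<mu> (kite x 1 d' e d' e)"
    using assms e pr by (intro kite_exchange) auto
  then have "\<mu> (kite x 1 (d + d') e d' e) $ 1 + \<mu> (kite x 1 d' e 0 e) $ 1
      = \<mu> (kite x 1 (d + d') e 0 e) $ 1 + \<mu> (kite x 1 d' e d' e) $ 1"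
    by (simp add: pt_eq_iff)
  moreover have "\<mu> (kite x 1 d' e d' e) $ 1 = 2 * V1 x e"
    using assms e by (simp add: kite_same_slope)
  ultimately show ?thesis
    using assms e by (simp add: kite_formula pr algebra_simps)
qed

text \<open>A normal form under maps of determinant 1. The first vertex is the left end of the
  section with the axis; the second lies on the vertical axis, so that the kite below has lower
  inverse slope 0.\<close>

definition triangle :: "real \<Rightarrow> real \<Rightarrow> real \<Rightarrow> pt set" where
  "triangle a b c = convex hull {pnt (-1) 0, pnt 0 (- c), pnt (a / c) b}"

text \<open>The axis leaves the triangle through the edge opposite to (-1, 0), and this exit point
  may be added as a redundant vertex. The kite is degenerate: its first \<open>proper\<close> bound
  is an equality.\<close>

lemma triangle_eq_kite:
  assumes "a > 0" "b > 0" "c > 0"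
  shows "triangle a b c = kite (a / (b + c)) 1 (a / (b * c)) b 0 c"
proof -
  have "pnt (a / (b + c)) 0 = (b / (b + c)) *\<^sub>R pnt 0 (- c) + (c / (b + c)) *\<^sub>R pnt (a / c) b"
    using assms by (simp add: pt_eq_iff)
  moreover have "b / (b + c) + c / (b + c) = 1"
    using assms by (simp add: add_divide_distrib[symmetric])
  ultimately have "pnt (a / (b + c)) 0 \<in> convex hull {pnt 0 (- c), pnt (a / c) b}"
    unfolding convex_hull_2 using assms by (intro CollectI exI conjI) auto
  then have "pnt (a / (b + c)) 0 \<in> triangle a b c"
    unfolding triangle_def by (rule hull_mono[THEN subsetD, rotated]) auto
  then have "convex hull (insert (pnt (a / (b + c)) 0) {pnt (-1) 0, pnt 0 (- c), pnt (a / c) b})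
      = triangle a b c"
    unfolding triangle_def by (rule hull_redundant)
  moreover have "a / (b * c) * b = a / c" using assms by simp
  ultimately show ?thesis by (simp add: kite_def quad_def insert_commute)
qed

text \<open>The matrix takes the first, second and third vertex to the third, first and second
  vertex of the relabelled triangle.\<close>

lemma triangle_rotate:
  assumes "a > 0" "b > 0" "c > 0"
  shows "\<mu> (triangle b c a) = mat2 (- b / a) (1 / c) (- c) 0 *v \<mu> (triangle a b c)"
proof (subst covariant[symmetric])
  show "triangle a b c \<in> polygons_o"
    unfolding triangle_eq_kite[OF assms] using assms by (intro kite_in_polygons_o) auto
  show "mat2 (- b / a) (1 / c) (- c) 0 \<in> VL2" using assms by (simp add: mat2_in_VL2)
  have "(\<lambda>x. mat2 (- b / a) (1 / c) (- c) 0 *v x) ` triangle a b c = triangle b c a"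
    unfolding triangle_def using assms
    by (subst convex_hull_linear_image) (auto simp: mat2_mult insert_commute)
  then show "\<mu> (triangle b c a) = \<mu> ((\<lambda>x. mat2 (- b / a) (1 / c) (- c) 0 *v x) ` triangle a b c)"
    by simp
qed

lemma mu_triangle:
  assumes "a > 0" "b > 0" "c > 0"
  defines "x \<equiv> a / (b + c)"
  shows "\<mu> (triangle a b c) $ 1 = V1 x b + V1 x c + a / (b * c) * V2 x b + \<psi> x (a / (b * c))"
    and "\<mu> (triangle a b c) $ 2 = V2 x b - V2 x c"
proof -
  have "1 / b + 1 / c = (b + c) / (b * c)" using assms(2,3) by (simp add: field_simps)
  then have "proper x 1 (a / (b * c)) b 0 c"
    using assms(1-3) divide_pos_pos[of a "b * c"] divide_pos_pos[of "b + c" "b * c"]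
    unfolding proper_def x_def by (simp del: divide_pos_pos)
  moreover have "x > 0" using assms by (simp add: x_def)
  ultimately show "\<mu> (triangle a b c) $ 1 = V1 x b + V1 x c + a / (b * c) * V2 x b + \<psi> x (a / (b * c))"
    "\<mu> (triangle a b c) $ 2 = V2 x b - V2 x c"
    unfolding triangle_eq_kite[OF assms(1-3)] x_def[symmetric]
    using assms(2,3) by (simp_all add: kite_formula)
qed

sublocale triangle_equation f \<psi>
proof
  fix a b c :: real assume abc: "a > 0" "b > 0" "c > 0"
  \<comment> \<open>The second row is taken because its left side is free of \<psi>, so that \<psi>
    enters the equation only once.\<close>
  have "\<mu> (triangle b c a) $ 2 = - c * \<mu> (triangle a b c) $ 1"
    by (simp add: triangle_rotate[OF abc] mat2_mult)
  then have "V2 (b / (c + a)) c - V2 (b / (c + a)) a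
    = - c * (V1 (a / (b + c)) b + V1 (a / (b + c)) c + a / (b * c) * V2 (a / (b + c)) b
      + \<psi> (a / (b + c)) (a / (b * c)))"
    unfolding mu_triangle[OF abc] mu_triangle[OF abc(2,3,1)] .
  then have "2 * b * (V2 (b / (c + a)) c - V2 (b / (c + a)) a)
    + 2 * b * c * (V1 (a / (b + c)) b + V1 (a / (b + c)) c + a / (b * c) * V2 (a / (b + c)) b
      + \<psi> (a / (b + c)) (a / (b * c))) = 0"
    by simp
  moreover have "2 * b * V2 (b / (c + a)) s = (a + c) * f (b * s / (a + c)) + b * f s" for s
    using abc by (simp add: V2_def field_simps)
  moreover have "2 * b * c * V1 (a / (b + c)) b = c * (f (a * b / (b + c)) - f b)"
    "2 * b * c * V1 (a / (b + c)) c = b * (f (a * c / (b + c)) - f c)"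
    using abc by (simp_all add: V1_def field_simps)
  moreover have "2 * b * c * (a / (b * c) * V2 (a / (b + c)) b) = (b + c) * f (a * b / (b + c)) + a * f b"
    using abc by (simp add: V2_def field_simps)
  ultimately show "(b + 2 * c) * f (a * b / (b + c)) + b * f (a * c / (b + c)) + (a - c) * f b - b * f a
      + 2 * b * c * \<psi> (a / (b + c)) (a / (b * c))
      + (a + c) * (f (b * c / (a + c)) - f (a * b / (a + c))) = 0"
    by (simp add: right_diff_distrib distrib_left mult.commute[of b a]) (simp add: algebra_simps)
qed (simp_all add: psi_add f_one)

end

section \<open>Valuations vanishing on quadrilaterals\<close>

definition cross :: "pt \<Rightarrow> pt \<Rightarrow> real" where
  "cross u v = u$1 * v$2 - u$2 * v$1"

lemma linear_cross: "linear (cross w)" "linear (\<lambda>p. cross p w)"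
  by (auto intro!: linearI simp: cross_def algebra_simps)

lemma cross_simps [simp]:
  "cross w w = 0" "cross 0 v = 0" "cross u 0 = 0" "cross (- u) v = - cross u v" "cross u (- v) = - cross u v"
  "cross (c *\<^sub>R u) v = c * cross u v" "cross u (c *\<^sub>R v) = c * cross u v"
  "cross (u + u') v = cross u v + cross u' v" "cross u (v + v') = cross u v + cross u v'"
  "cross (u - u') v = cross u v - cross u' v" "cross u (v - v') = cross u v - cross u v'"
  by (auto simp: cross_def algebra_simps)

lemma cross_swap: "cross u v = - cross v u"
  by (simp add: cross_def)

lemma cross_eq_0_obtain:
  assumes "cross w p = 0" "w \<noteq> 0"
  obtains k where "p = k *\<^sub>R w"
proof (cases "w$1 = 0")
  case True
  then have "w$2 \<noteq> 0" using assms(2) by (simp add: pt_eq_iff)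
  with True assms(1) have "p = (p$2 / w$2) *\<^sub>R w"
    by (simp add: pt_eq_iff cross_def)
  then show ?thesis by (rule that)
next
  case False
  with assms(1) have "p = (p$1 / w$1) *\<^sub>R w"
    by (simp add: pt_eq_iff cross_def field_simps)
  then show ?thesis by (rule that)
qed

lemma in_segment_opposite:
  assumes "- e \<le> k" "k \<le> 1" "e > 0"
  shows "k *\<^sub>R w \<in> convex hull {w, (- e) *\<^sub>R w}"
  unfolding convex_hull_2
proof (intro CollectI exI conjI)
  define l where "l = 1 / (1 + e)"
  have l: "l * (1 + e) = 1" "l > 0" using assms by (auto simp: l_def)
  have "k = (k + e) * l - (1 - k) * l * e" using l(1) by algebra
  then have "k = (k + e) * l + (1 - k) * l * (- e)" by simp
  then show "k *\<^sub>R w = ((k + e) * l) *\<^sub>R w + ((1 - k) * l) *\<^sub>R (- e) *\<^sub>R w"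
    by (metis scaleR_add_left scaleR_scaleR)
  show "(k + e) * l + (1 - k) * l = 1" using l(1) by algebra
  show "0 \<le> (k + e) * l" "0 \<le> (1 - k) * l" using assms l(2) by auto
qed

text \<open>Coordinates adapted to the diagonal: \<open>A\<close> takes the axis to the line of
  \<open>w\<close>, with scale fixed by sending (-1, 0) to \<open>- b\<close> times
  \<open>w\<close>; its second column is orthogonal to \<open>w\<close> and makes the determinant 1.
  Properness is a conditional conclusion because membership in \<open>polygons_o\<close> is also
  derived from this lemma without knowing the section.\<close>

lemma quad_as_kite:
  assumes "w \<noteq> 0" "b > 0" "cross w u > 0" "cross w v < 0"
  obtains A x \<sigma> s \<tau> t where "A \<in> VL2" "x > 0" "s > 0" "t > 0"
    "convex hull {w, (- b) *\<^sub>R w, u, v} = (\<lambda>p. A *v p) ` kite x 1 \<sigma> s \<tau> t"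
    "(\<And>p. p \<in> convex hull {w, (- b) *\<^sub>R w, u, v} \<Longrightarrow> cross w p = 0 \<Longrightarrow> p \<in> convex hull {w, (- b) *\<^sub>R w})
      \<Longrightarrow> proper x 1 \<sigma> s \<tau> t"
proof -
  define x where "x = 1 / b"
  have x: "x > 0" "1 / x = b" using assms by (auto simp: x_def)
  define K where "K = (w$1)\<^sup>2 + (w$2)\<^sup>2"
  have K: "K > 0" using assms(1) by (auto simp: K_def pt_eq_iff sum_power2_gt_zero_iff)
  define A where "A = mat2 (w$1 / x) (- x * w$2 / K) (w$2 / x) (x * w$1 / K)"
  define c1 where "c1 p = x * (w \<bullet> p) / K" for p
  define c2 where "c2 p = cross w p / x" for p
  have coord: "A *v pnt (c1 p) (c2 p) = p" for p
  proof -
    have "w$1 * (w \<bullet> p) - w$2 * cross w p = K * p$1" "w$2 * (w \<bullet> p) + w$1 * cross w p = K * p$2"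
      unfolding K_def cross_def inner_pt power2_eq_square by algebra+
    then have "(w$1 * (w \<bullet> p) - w$2 * cross w p) / K = p$1" "(w$2 * (w \<bullet> p) + w$1 * cross w p) / K = p$2"
      using K by auto
    then show ?thesis
      using x(1) unfolding A_def mat2_mult
      by (simp add: pt_eq_iff c1_def c2_def diff_divide_distrib add_divide_distrib)
  qed
  have "A \<in> VL2"
  proof -
    have "w$1 / x * (x * w$1 / K) - (- x * w$2 / K) * (w$2 / x) = ((w$1)\<^sup>2 + (w$2)\<^sup>2) / K"
      using x K by (simp add: power2_eq_square add_divide_distrib)
    also have "\<dots> = 1" using K unfolding K_def[symmetric] by simp
    finally show ?thesis unfolding A_def mat2_in_VL2 by simp
  qed
  have Aw: "A *v pnt x 0 = w" "A *v pnt (-1) 0 = (- b) *\<^sub>R w"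
    using x unfolding A_def mat2_mult by (auto simp: pt_eq_iff x_def)
  define s where "s = c2 u"
  define t where "t = - c2 v"
  have st: "s > 0" "t > 0" using assms x by (auto simp: s_def t_def c2_def divide_neg_pos)
  define \<sigma> where "\<sigma> = c1 u / s"
  define \<tau> where "\<tau> = - c1 v / t"
  have uv: "A *v pnt (\<sigma> * s) s = u" "A *v pnt (- \<tau> * t) (- t) = v"
    using coord[of u] coord[of v] st by (auto simp: \<sigma>_def \<tau>_def s_def t_def)
  have img: "convex hull {w, (- b) *\<^sub>R w, u, v} = (\<lambda>p. A *v p) ` kite x 1 \<sigma> s \<tau> t"
    unfolding kite_def image_quad Aw uv by (rule refl)
  have "proper x 1 \<sigma> s \<tau> t"
    if sec: "\<And>p. p \<in> convex hull {w, (- b) *\<^sub>R w, u, v} \<Longrightarrow> cross w p = 0 \<Longrightarrow> p \<in> convex hull {w, (- b) *\<^sub>R w}"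
  proof -
    define l where "l = 1 / (s + t)"
    have l: "l > 0" "t * l + s * l = 1" "l * (s + t) = 1"
      using st by (auto simp: l_def add_divide_distrib[symmetric] add.commute)
    \<comment> \<open>The point where the segment from \<open>u\<close> to \<open>v\<close> crosses
      the line of \<open>w\<close>; \<open>proper\<close> says that it lies on the diagonal.\<close>
    define p where "p = (t * l) *\<^sub>R u + (s * l) *\<^sub>R v"
    have "p \<in> convex hull {u, v}"
      unfolding convex_hull_2 p_def using l st by (intro CollectI exI conjI) auto
    then have "p \<in> convex hull {w, (- b) *\<^sub>R w, u, v}"
      by (rule hull_mono[THEN subsetD, rotated]) auto
    moreover have "cross w u = x * s" "cross w v = - x * t"
      using x by (auto simp: s_def t_def c2_def)
    then have "cross w p = 0" by (simp add: p_def)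
    ultimately have "p \<in> convex hull {w, (- b) *\<^sub>R w}" by (rule sec)
    then obtain i j where ij: "0 \<le> i" "0 \<le> j" "i + j = 1" "p = i *\<^sub>R w + j *\<^sub>R (- b) *\<^sub>R w"
      by (auto simp: convex_hull_2)
    have "w \<bullet> w = K" by (simp add: K_def inner_pt power2_eq_square)
    then have "c1 p = x * i - x * b * j"
      using K by (simp add: c1_def ij(4) inner_diff_right algebra_simps diff_divide_distrib)
    then have "c1 p = x * i - j" using x by (simp add: x_def)
    moreover have "c1 p = t * l * c1 u + s * l * c1 v"
      using K by (simp add: c1_def p_def inner_add_right field_simps)
    moreover have "c1 u = \<sigma> * s" "c1 v = - \<tau> * t" using st by (auto simp: \<sigma>_def \<tau>_def)
    ultimately have eq: "s * t * l * (\<sigma> - \<tau>) = x * i - j" by (simp add: algebra_simps)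
    have e: "1 / s + 1 / t = 1 / (s * t * l)"
      using st l(1) by (simp add: l_def field_simps)
    have stl: "s * t * l > 0" using st l by simp
    have "x * i \<le> x * 1" using ij x by (intro mult_left_mono) auto
    then have "x * i - j \<le> x" using ij by linarith
    then have "(\<sigma> - \<tau>) * (s * t * l) \<le> x" using eq by (simp add: mult.commute)
    then have "\<sigma> - \<tau> \<le> x * (1 / (s * t * l))" using stl by (simp add: pos_le_divide_eq)
    moreover have "j - x * i \<le> 1" using ij x mult_nonneg_nonneg[of x i] by linarith
    then have "(\<tau> - \<sigma>) * (s * t * l) \<le> 1" using eq by (simp add: algebra_simps)
    then have "\<tau> - \<sigma> \<le> 1 * (1 / (s * t * l))" using stl by (simp add: pos_le_divide_eq)
    ultimately show ?thesis unfolding proper_def e by simp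
  qed
  with img st x(1) \<open>A \<in> VL2\<close> show ?thesis by (intro that[of A x s t \<sigma> \<tau>]) auto
qed

lemma opposite_quad_in_polygons_o:
  assumes "w \<noteq> 0" "b > 0" "cross w u > 0" "cross w v < 0"
  shows "convex hull {w, (- b) *\<^sub>R w, u, v} \<in> polygons_o"
proof -
  obtain A x \<sigma> s \<tau> t where "A \<in> VL2" "x > 0" "s > 0" "t > 0"
    "convex hull {w, (- b) *\<^sub>R w, u, v} = (\<lambda>p. A *v p) ` kite x 1 \<sigma> s \<tau> t"
    using quad_as_kite[OF assms] by metis
  then show ?thesis by (simp add: polygons_o_imageI kite_in_polygons_o)
qed

lemma polygons_o_superset:
  assumes "N \<in> polygons_o" "N \<subseteq> convex hull S" "finite S"
  shows "convex hull S \<in> polygons_o"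
  using assms interior_mono[OF assms(2)] by (auto simp: polygons_o_altdef polytope_convex_hull)

lemma small_multiple_in:
  assumes "P \<in> polygons_o"
  obtains e where "e > 0" "(- e) *\<^sub>R w \<in> P"
proof -
  obtain r where r: "r > 0" "ball 0 r \<subseteq> P"
    using assms unfolding polygons_o_altdef mem_interior by auto
  define e where "e = r / (1 + norm w)"
  have n: "1 + norm w > 0" by (simp add: add_pos_nonneg)
  then have "e > 0" using r by (simp add: e_def)
  have "e * norm w < e * (1 + norm w)" using \<open>e > 0\<close> by simp
  also have "\<dots> = r" using n unfolding e_def by simp
  finally have "(- e) *\<^sub>R w \<in> ball 0 r" using \<open>e > 0\<close> by simp
  with r \<open>e > 0\<close> show ?thesis by (blast intro: that)
qed

text \<open>The line from \<open>n\<close> through the origin meets the opposite edge in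
  \<open>w\<close>, which makes the triangle a degenerate quadrilateral with diagonal from
  \<open>w\<close> to \<open>n\<close>.\<close>

lemma cone_triangle_section:
  assumes ab: "cross a b > 0" "cross a n < 0" "cross n b < 0"
  obtains w e where "e > 0" "n = (- e) *\<^sub>R w" "w \<noteq> 0" "cross w b > 0" "cross w a < 0"
    "w \<in> convex hull {a, b}"
    "\<And>p. p \<in> convex hull {a, b, n} \<Longrightarrow> cross w p = 0 \<Longrightarrow> p \<in> convex hull {w, n}"
proof -
  define D where "D = cross a b"
  have D: "D > 0" using ab by (simp add: D_def)
  \<comment> \<open>By Cramer's rule \<open>x\<close> and \<open>y\<close> are the coordinates of
    \<open>- n\<close> in the basis \<open>a\<close>, \<open>b\<close>.\<close>
  define x where "x = - cross n b / D"
  define y where "y = - cross a n / D"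
  have xy: "x > 0" "y > 0" using ab D by (auto simp: x_def y_def divide_neg_pos)
  have n: "n = - (x *\<^sub>R a + y *\<^sub>R b)"
  proof -
    have "D * n$1 = cross n b * a$1 + cross a n * b$1" "D * n$2 = cross n b * a$2 + cross a n * b$2"
      unfolding D_def cross_def by algebra+
    then show ?thesis using D by (simp add: pt_eq_iff x_def y_def field_simps)
  qed
  define e where "e = x + y"
  have e: "e > 0" using xy by (simp add: e_def)
  define w where "w = (x / e) *\<^sub>R a + (y / e) *\<^sub>R b"
  have nw: "n = (- e) *\<^sub>R w" using e by (simp add: w_def n scaleR_add_right)
  have xe: "x / e + y / e = 1" using e by (simp add: e_def add_divide_distrib[symmetric])
  have wb: "cross w b = x / e * D" "cross w a = - (y / e * D)"
    by (auto simp: w_def D_def cross_swap[of b a])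
  have "w \<in> convex hull {a, b}"
    unfolding convex_hull_2 w_def using xy e xe by (intro CollectI exI conjI) auto
  moreover have "p \<in> convex hull {w, n}" if p: "p \<in> convex hull {a, b, n}" and c: "cross w p = 0" for p
  proof -
    obtain i j k where ijk: "0 \<le> i" "0 \<le> j" "0 \<le> k" "i + j + k = 1" "p = i *\<^sub>R a + j *\<^sub>R b + k *\<^sub>R n"
      using p unfolding convex_hull_3 by blast
    have "cross w n = 0" by (simp add: nw)
    then have "i * (y / e * D) = j * (x / e * D)" using c by (auto simp: ijk(5) wb)
    then have "i * (y / e) * D = j * (x / e) * D" by simp
    then have iy: "i * (y / e) = j * (x / e)" using D by simp
    have "(i + j) * (x / e) = i" "(i + j) * (y / e) = j" using iy xe by algebra+
    then have "p = (i + j) *\<^sub>R w + k *\<^sub>R n"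
      by (simp add: ijk(5) w_def scaleR_add_right)
    then show ?thesis unfolding convex_hull_2 using ijk by (intro CollectI exI conjI) auto
  qed
  moreover have "w \<noteq> 0" using wb xy e D by auto
  ultimately show ?thesis using e nw wb xy D by (intro that[of e w]) auto
qed

lemma cone_triangle_eq:
  assumes "w \<in> convex hull {a, b}"
  shows "convex hull {w, n, b, a} = convex hull {a, b, n}"
proof -
  have "w \<in> convex hull {a, b, n}"
    using assms by (rule hull_mono[THEN subsetD, rotated]) auto
  then have "convex hull (insert w {a, b, n}) = convex hull {a, b, n}"
    by (rule hull_redundant)
  then show ?thesis by (simp add: insert_commute)
qed

lemma cone_triangle_in_polygons_o:
  assumes "cross a b > 0" "cross a n < 0" "cross n b < 0"
  shows "convex hull {a, b, n} \<in> polygons_o"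
proof -
  obtain w e where "e > 0" "n = (- e) *\<^sub>R w" "w \<noteq> 0" "cross w b > 0" "cross w a < 0"
    "w \<in> convex hull {a, b}" using cone_triangle_section[OF assms] by metis
  then show ?thesis using opposite_quad_in_polygons_o[of w e b a] cone_triangle_eq[of w a b n] by simp
qed

section \<open>Cutting polygons when \<open>f\<close> vanishes\<close>

locale kite_null_valuation = covariant_valuation +
  assumes f_null: "\<And>x. x > 0 \<Longrightarrow> f x = 0"
begin

lemma mu_kite_null:
  assumes "x > 0" "s > 0" "t > 0" "proper x 1 \<sigma> s \<tau> t"
  shows "\<mu> (kite x 1 \<sigma> s \<tau> t) = 0"
  using assms by (simp add: pt_eq_iff kite_formula V1_def V2_def f_null psi_eq_zero)

lemma mu_opposite_quad:
  assumes "w \<noteq> 0" "b > 0" "cross w u > 0" "cross w v < 0"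
    and "\<And>p. p \<in> convex hull {w, (- b) *\<^sub>R w, u, v} \<Longrightarrow> cross w p = 0 \<Longrightarrow> p \<in> convex hull {w, (- b) *\<^sub>R w}"
  shows "\<mu> (convex hull {w, (- b) *\<^sub>R w, u, v}) = 0"
proof -
  obtain A x \<sigma> s \<tau> t where "A \<in> VL2" "x > 0" "s > 0" "t > 0" "proper x 1 \<sigma> s \<tau> t"
    "convex hull {w, (- b) *\<^sub>R w, u, v} = (\<lambda>p. A *v p) ` kite x 1 \<sigma> s \<tau> t"
    using quad_as_kite[OF assms(1-4)] assms(5) by metis
  then show ?thesis by (simp add: covariant kite_in_polygons_o mu_kite_null)
qed

lemma mu_cone_triangle:
  assumes "cross a b > 0" "cross a n < 0" "cross n b < 0"
  shows "\<mu> (convex hull {a, b, n}) = 0"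
proof -
  obtain w e where w: "e > 0" "n = (- e) *\<^sub>R w" "w \<noteq> 0" "cross w b > 0" "cross w a < 0"
    "w \<in> convex hull {a, b}"
    "\<And>p. p \<in> convex hull {a, b, n} \<Longrightarrow> cross w p = 0 \<Longrightarrow> p \<in> convex hull {w, n}"
    using cone_triangle_section[OF assms] by metis
  have "\<mu> (convex hull {w, (- e) *\<^sub>R w, b, a}) = 0"
    using w(7) unfolding w(2)[symmetric] cone_triangle_eq[OF w(6)]
    by (intro mu_opposite_quad[of w e b a, folded w(2), unfolded cone_triangle_eq[OF w(6)]] w) auto
  then show ?thesis unfolding w(2)[symmetric] cone_triangle_eq[OF w(6)] .
qed

text \<open>The upper half \<open>A'\<close> gets a triangular cap with apex \<open>n1\<close> below
  the cut, the lower half \<open>B'\<close> one with apex \<open>n2\<close> above it. Each cap lies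
  in the opposite half, so the capped halves unite to the whole polygon; they meet in the
  quadrilateral formed by the two caps, where \<mu> is 0.\<close>

lemma mu_cut:
  fixes A B :: "pt set"
  assumes fin: "finite A" "finite B" and w: "w \<noteq> 0" "e > 0" and n: "n = (- e) *\<^sub>R w"
    and A: "\<And>p. p \<in> A \<Longrightarrow> cross w p \<ge> 0" and B: "\<And>p. p \<in> B \<Longrightarrow> cross w p \<le> 0"
    and sec: "\<And>p. p \<in> convex hull (A \<union> B \<union> {w, n}) \<Longrightarrow> cross w p = 0 \<Longrightarrow> p \<in> convex hull {w, n}"
    and n1: "n1 \<in> convex hull (A \<union> B \<union> {w, n})" "cross w n1 < 0"
    and n2: "n2 \<in> convex hull (A \<union> B \<union> {w, n})" "cross w n2 > 0"
  shows "\<mu> (convex hull (A \<union> B \<union> {w, n}))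
    = \<mu> (convex hull (A \<union> {n1} \<union> {w, n})) + \<mu> (convex hull ({n2} \<union> B \<union> {w, n}))"
proof -
  define L where "L = convex hull (A \<union> B \<union> {w, n})"
  define A' where "A' = convex hull (A \<union> {w, n})"
  define B' where "B' = convex hull (B \<union> {w, n})"
  define t1 where "t1 = convex hull ({n1} \<union> {w, n})"
  define t2 where "t2 = convex hull ({n2} \<union> {w, n})"
  have wn: "cross w p = 0" if "p \<in> {w, n}" for p using that by (auto simp: n)
  have L: "L = A' \<union> B'"
    unfolding L_def A'_def B'_def
    by (rule convex_hull_split_across_line[OF linear_cross(1)]) (use A B wn sec in auto)
  have sub: "A \<union> B \<union> {w, n} \<subseteq> L" unfolding L_def by (rule hull_subset)
  have mono: "convex hull X \<subseteq> L" if "X \<subseteq> L" for X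
    using that unfolding L_def by (simp add: hull_minimal)
  have sec': "p \<in> convex hull {w, n}" if "p \<in> convex hull X" "X \<subseteq> L" "cross w p = 0" for p X
    using mono[of X] that sec unfolding L_def by blast
  have A'_pos: "cross w p \<ge> 0" if "p \<in> A'" for p
    by (rule linear_sign_convex_hull(1)[OF linear_cross(1), of "A \<union> {w, n}"]) (use A wn that in \<open>auto simp: A'_def\<close>)
  have B'_neg: "cross w p \<le> 0" if "p \<in> B'" for p
    by (rule linear_sign_convex_hull(2)[OF linear_cross(1), of "B \<union> {w, n}"]) (use B wn that in \<open>auto simp: B'_def\<close>)
  have n1B: "n1 \<in> B'" using n1 L A'_pos[of n1] unfolding L_def by fastforce
  have n2A: "n2 \<in> A'" using n2 L B'_neg[of n2] unfolding L_def by fastforce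
  have R1: "convex hull (A \<union> {n1} \<union> {w, n}) = A' \<union> t1"
    unfolding A'_def t1_def
  proof (rule convex_hull_split_across_line[OF linear_cross(1)])
    fix p assume "p \<in> convex hull (A \<union> {n1} \<union> {w, n})" "cross w p = 0"
    moreover have "A \<union> {n1} \<union> {w, n} \<subseteq> L" using sub n1B L by auto
    ultimately show "p \<in> convex hull {w, n}" using sec' by blast
  qed (use A n1 wn in auto)
  have R2: "convex hull ({n2} \<union> B \<union> {w, n}) = t2 \<union> B'"
    unfolding B'_def t2_def
  proof (rule convex_hull_split_across_line[OF linear_cross(1)])
    fix p assume "p \<in> convex hull ({n2} \<union> B \<union> {w, n})" "cross w p = 0"
    moreover have "{n2} \<union> B \<union> {w, n} \<subseteq> L" using sub n2A L by auto
    ultimately show "p \<in> convex hull {w, n}" using sec' by blast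
  qed (use B n2 wn in auto)
  have N: "convex hull ({n2} \<union> {n1} \<union> {w, n}) = t2 \<union> t1"
    unfolding t1_def t2_def
  proof (rule convex_hull_split_across_line[OF linear_cross(1)])
    fix p assume "p \<in> convex hull ({n2} \<union> {n1} \<union> {w, n})" "cross w p = 0"
    moreover have "{n2} \<union> {n1} \<union> {w, n} \<subseteq> L" using sub n2A n1B L by auto
    ultimately show "p \<in> convex hull {w, n}" using sec' by blast
  qed (use n1 n2 wn in auto)
  have N_eq: "{n2} \<union> {n1} \<union> {w, n} = {w, (- e) *\<^sub>R w, n2, n1}" by (auto simp: n)
  have NP: "t2 \<union> t1 \<in> polygons_o"
    unfolding N[symmetric] N_eq using w n1 n2 by (intro opposite_quad_in_polygons_o) auto
  have "\<mu> (t2 \<union> t1) = 0"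
    unfolding N[symmetric] N_eq
  proof (rule mu_opposite_quad)
    fix p assume "p \<in> convex hull {w, (- e) *\<^sub>R w, n2, n1}" "cross w p = 0"
    moreover have "{w, (- e) *\<^sub>R w, n2, n1} \<subseteq> L" using sub n2A n1B L by (auto simp: n)
    ultimately show "p \<in> convex hull {w, (- e) *\<^sub>R w}" using sec' unfolding n by blast
  qed (use w n1 n2 in auto)
  have t1B: "t1 \<subseteq> B'" and t2A: "t2 \<subseteq> A'"
    using n1B n2A hull_subset[of "B \<union> {w, n}" convex] hull_subset[of "A \<union> {w, n}" convex]
    unfolding t1_def t2_def A'_def B'_def by (intro hull_minimal; auto)+
  have AB: "A' \<inter> B' \<subseteq> t1"
  proof
    fix p assume p: "p \<in> A' \<inter> B'"
    then have "cross w p = 0" using A'_pos[of p] B'_neg[of p] by auto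
    then have "p \<in> convex hull {w, n}" using p L sec unfolding L_def by blast
    then show "p \<in> t1" unfolding t1_def by (rule hull_mono[THEN subsetD, rotated]) auto
  qed
  have un: "(A' \<union> t1) \<union> (t2 \<union> B') = L" "(A' \<union> t1) \<inter> (t2 \<union> B') = t2 \<union> t1"
    using t1B t2A AB L by auto
  have P1: "A' \<union> t1 \<in> polygons_o"
    using polygons_o_superset[OF NP, of "A \<union> {n1} \<union> {w, n}"] t2A fin unfolding R1 by auto
  have P2: "t2 \<union> B' \<in> polygons_o"
    using polygons_o_superset[OF NP, of "{n2} \<union> B \<union> {w, n}"] t1B fin unfolding R2 by auto
  have PL: "L \<in> polygons_o"
    using polygons_o_superset[OF NP, of "A \<union> B \<union> {w, n}"] t1B t2A L fin
    unfolding L_def[symmetric] by auto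
  have "\<mu> L + \<mu> (t2 \<union> t1) = \<mu> (A' \<union> t1) + \<mu> (t2 \<union> B')"
    using valuationD[OF P1 P2] PL by (simp add: un)
  then show ?thesis using \<open>\<mu> (t2 \<union> t1) = 0\<close> unfolding R1 R2 L_def[symmetric] by simp
qed

text \<open>\<open>l a b\<close> is constant on the line through \<open>a\<close> and \<open>b\<close>; only the part of the hull beyond that line
  matters.\<close>

lemma mu_bottom:
  fixes S Y1 Y2 :: "pt set"
  defines "l \<equiv> \<lambda>a b p. cross p (b - a)"
  assumes fin: "finite S" "finite Y1" "finite Y2"
    and S: "\<And>p. p \<in> S \<Longrightarrow> l a b p \<ge> cross a b"
    and Y1: "\<And>p. p \<in> Y1 \<Longrightarrow> l a b p \<le> cross a b"
    and Y: "Y2 \<subseteq> convex hull (Y1 \<union> {a, b})"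
    and sec: "\<And>p. p \<in> convex hull (S \<union> Y1 \<union> {a, b}) \<Longrightarrow> l a b p = cross a b \<Longrightarrow> p \<in> convex hull {a, b}"
    and P: "convex hull (Y2 \<union> {a, b}) \<in> polygons_o"
    and null: "\<mu> (convex hull (Y1 \<union> {a, b})) = 0" "\<mu> (convex hull (Y2 \<union> {a, b})) = 0"
  shows "\<mu> (convex hull (S \<union> Y1 \<union> {a, b})) = \<mu> (convex hull (S \<union> Y2 \<union> {a, b}))"
proof -
  let ?D = "cross a b"
  have lin: "linear (l a b)" unfolding l_def by (rule linear_cross)
  have ab: "l a b p = ?D" if "p \<in> {a, b}" for p
    using that by (auto simp: l_def cross_swap[of b a])
  define C where "C = convex hull (S \<union> {a, b})"
  define B1 where "B1 = convex hull (Y1 \<union> {a, b})"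
  define B2 where "B2 = convex hull (Y2 \<union> {a, b})"
  have B21: "B2 \<subseteq> B1"
    unfolding B1_def B2_def using Y hull_subset[of "Y1 \<union> {a, b}" convex] by (intro hull_minimal) auto
  have B1_le: "l a b p \<le> ?D" if "p \<in> B1" for p
    by (rule linear_sign_convex_hull(2)[OF lin, of "Y1 \<union> {a, b}"]) (use that Y1 ab in \<open>force simp: B1_def\<close>)+
  have C_ge: "l a b p \<ge> ?D" if "p \<in> C" for p
    by (rule linear_sign_convex_hull(1)[OF lin, of "S \<union> {a, b}"]) (use that S ab in \<open>force simp: C_def\<close>)+
  have L1: "convex hull (S \<union> Y1 \<union> {a, b}) = C \<union> B1"
    unfolding C_def B1_def by (rule convex_hull_split_across_line[OF lin S Y1 ab sec])
  have sub: "convex hull (S \<union> Y2 \<union> {a, b}) \<subseteq> convex hull (S \<union> Y1 \<union> {a, b})"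
    using Y hull_subset[of "S \<union> Y1 \<union> {a, b}" convex] hull_mono[of "Y1 \<union> {a, b}" "S \<union> Y1 \<union> {a, b}" convex]
    by (intro hull_minimal) auto
  have Y2: "l a b p \<le> ?D" if "p \<in> Y2" for p
    using that Y B1_le unfolding B1_def by auto
  have L2: "convex hull (S \<union> Y2 \<union> {a, b}) = C \<union> B2"
    unfolding C_def B2_def by (rule convex_hull_split_across_line[OF lin S Y2 ab]) (use sub sec in blast)+
  have "C \<inter> B1 \<subseteq> B2"
  proof
    fix p assume p: "p \<in> C \<inter> B1"
    then have "l a b p = ?D" using C_ge[of p] B1_le[of p] by auto
    then have "p \<in> convex hull {a, b}" using p L1 by (intro sec) auto
    then show "p \<in> B2" unfolding B2_def by (rule hull_mono[THEN subsetD, rotated]) auto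
  qed
  \<comment> \<open>The new polygon and the old bottom unite to the old polygon and meet in the new
    bottom; both bottoms have value 0.\<close>
  then have un: "(C \<union> B2) \<union> B1 = C \<union> B1" "(C \<union> B2) \<inter> B1 = B2" using B21 by auto
  have P': "C \<union> B2 \<in> polygons_o" "B1 \<in> polygons_o" "C \<union> B1 \<in> polygons_o"
    using polygons_o_superset[OF P, of "S \<union> Y2 \<union> {a, b}"] polygons_o_superset[OF P, of "Y1 \<union> {a, b}"]
      polygons_o_superset[OF P, of "S \<union> Y1 \<union> {a, b}"] fin B21
    unfolding L1 L2 B1_def[symmetric] B2_def[symmetric] by auto
  have "\<mu> (C \<union> B1) + \<mu> B2 = \<mu> (C \<union> B2) + \<mu> B1"
    using valuationD[OF P'(1,2)] P'(3) unfolding un .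
  then show ?thesis using null unfolding L1 L2 B1_def[symmetric] B2_def[symmetric] by simp
qed

text \<open>The inequality with \<open>b - a\<close> places a point beyond the line of
  \<open>a\<close> and \<open>b\<close>, as seen from the origin. So \<open>S\<close> is a cap over
  the edge from \<open>a\<close> to \<open>b\<close> of a triangle around the origin, inside the
  cone of that edge; the last condition says that the polygon meets the line of the edge only in the
  edge.\<close>

definition sector :: "pt set \<Rightarrow> pt \<Rightarrow> pt \<Rightarrow> pt \<Rightarrow> bool" where
  "sector S a b n \<longleftrightarrow> finite S \<and> cross a b > 0 \<and> cross a n < 0 \<and> cross n b < 0 \<and>
    (\<forall>s\<in>S. cross a s > 0 \<and> cross s b > 0 \<and> cross s (b - a) > cross a b) \<and>
    (\<forall>p\<in>convex hull (S \<union> {a, b, n}). cross p (b - a) = cross a b \<longrightarrow> p \<in> convex hull {a, b})"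

text \<open>In the basis \<open>c\<close>, \<open>d\<close> the point \<open>s\<close> has
  nonnegative coordinates with sum at most 1, so it lies in the triangle with vertices
  \<open>c\<close>, \<open>d\<close> and 0.\<close>

lemma low_in_triangle:
  assumes D: "cross c d > 0" "cross c n < 0" "cross n d < 0"
    and s: "cross c s \<ge> 0" "cross s d \<ge> 0" "cross s (d - c) \<le> cross c d"
  shows "s \<in> convex hull {c, d, n}"
proof -
  have "0 \<in> convex hull {c, d, n}"
    using cone_triangle_in_polygons_o[OF D] interior_subset by (auto simp: polygons_o_altdef)
  then have sub: "convex hull {c, d, 0} \<subseteq> convex hull {c, d, n}"
    by (intro hull_minimal) (auto intro: hull_inc)
  let ?D = "cross c d"
  have "?D * s$1 = cross s d * c$1 + cross c s * d$1" "?D * s$2 = cross s d * c$2 + cross c s * d$2"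
    unfolding cross_def by algebra+
  then have se: "s = (cross s d / ?D) *\<^sub>R c + (cross c s / ?D) *\<^sub>R d"
    using D(1) by (simp add: pt_eq_iff field_simps)
  have "cross s d / ?D + cross c s / ?D \<le> 1"
    using s(3) D(1) by (simp add: add_divide_distrib[symmetric] cross_swap[of s c])
  then have "s \<in> convex hull {c, d, 0}"
    unfolding convex_hull_3 using se s D(1)
    by (intro CollectI exI[of _ "cross s d / ?D"] exI[of _ "cross c s / ?D"]
        exI[of _ "1 - cross s d / ?D - cross c s / ?D"] conjI) auto
  then show ?thesis using sub by auto
qed

text \<open>A cut in \<open>mu_fan\<close> leaves a piece with two bottom vertices \<open>m\<close>
  and \<open>n\<close> and perhaps points not beyond the new edge. Such points are redundant,
  \<open>mu_bottom\<close> removes \<open>m\<close>, and what remains is a sector with at most the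
  points of \<open>T\<close>.\<close>

lemma mu_subsector:
  fixes T L :: "pt set"
  assumes "finite T" and cd: "cross c d > 0" "cross c n < 0" "cross n d < 0"
    and T: "\<And>s. s \<in> T \<Longrightarrow> cross c s > 0 \<and> cross s d > 0"
    and m: "cross m (d - c) \<le> cross c d"
    and L: "convex L" "T \<union> {m, n} \<union> {c, d} \<subseteq> L"
    and sec: "\<And>p. p \<in> L \<Longrightarrow> cross p (d - c) = cross c d \<Longrightarrow> p \<in> convex hull {c, d}"
    and null: "\<mu> (convex hull ({m, n} \<union> {c, d})) = 0"
    and IH: "\<And>T'. T' \<subseteq> T \<Longrightarrow> sector T' c d n \<Longrightarrow> \<mu> (convex hull (T' \<union> {c, d, n})) = 0"
  shows "\<mu> (convex hull (T \<union> {m, n} \<union> {c, d})) = 0"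
proof -
  define T' where "T' = {s \<in> T. cross s (d - c) > cross c d}"
  have T'T: "T' \<subseteq> T" "finite T'" using \<open>finite T\<close> by (auto simp: T'_def)
  have cdn: "{c, d, n} = {n} \<union> {c, d}" by auto
  have sub: "convex hull X \<subseteq> L" if "X \<subseteq> T \<union> {m, n} \<union> {c, d}" for X
    using that L by (intro hull_minimal) auto
  have "convex hull (T \<union> {m, n} \<union> {c, d}) = convex hull (T' \<union> {m, n} \<union> {c, d})"
  proof (rule antisym)
    have "s \<in> convex hull (T' \<union> {m, n} \<union> {c, d})" if "s \<in> T" for s
    proof (cases "s \<in> T'")
      case True then show ?thesis by (auto intro: hull_inc)
    next
      case False
      with that have "s \<in> convex hull {c, d, n}"
        using T[OF that] cd by (intro low_in_triangle) (auto simp: T'_def)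
      then show ?thesis by (rule hull_mono[THEN subsetD, rotated]) auto
    qed
    moreover have "{m, n} \<union> {c, d} \<subseteq> convex hull (T' \<union> {m, n} \<union> {c, d})"
      by (auto intro: hull_inc)
    ultimately show "convex hull (T \<union> {m, n} \<union> {c, d}) \<subseteq> convex hull (T' \<union> {m, n} \<union> {c, d})"
      by (intro hull_minimal) auto
    show "convex hull (T' \<union> {m, n} \<union> {c, d}) \<subseteq> convex hull (T \<union> {m, n} \<union> {c, d})"
      using T'T by (intro hull_mono) auto
  qed
  also have "\<mu> \<dots> = \<mu> (convex hull (T' \<union> {n} \<union> {c, d}))"
  proof (rule mu_bottom)
    show "convex hull ({n} \<union> {c, d}) \<in> polygons_o"
      using cone_triangle_in_polygons_o[OF cd] unfolding cdn .
    show "\<mu> (convex hull ({n} \<union> {c, d})) = 0"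
      using mu_cone_triangle[OF cd] unfolding cdn .
    show "p \<in> convex hull {c, d}"
      if "p \<in> convex hull (T' \<union> {m, n} \<union> {c, d})" "cross p (d - c) = cross c d" for p
      using that sub[of "T' \<union> {m, n} \<union> {c, d}"] T'T by (intro sec) auto
    have "cross n (d - c) \<le> cross c d" using cd by (simp add: cross_swap[of n c])
    then show "cross p (d - c) \<le> cross c d" if "p \<in> {m, n}" for p using that m by auto
    show "{n} \<subseteq> convex hull ({m, n} \<union> {c, d})" by (auto intro: hull_inc)
  qed (use T'T null in \<open>auto simp: T'_def\<close>)
  also have "T' \<union> {n} \<union> {c, d} = T' \<union> {c, d, n}" by auto
  also have "\<mu> (convex hull (T' \<union> {c, d, n})) = 0"
  proof (rule IH[OF T'T(1)])
    show "sector T' c d n"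
      unfolding sector_def using T'T T cd sub[of "T' \<union> {c, d, n}"] sec
      by (auto simp: T'_def)
  qed
  finally show ?thesis .
qed

lemma mu_fan:
  fixes S :: "pt set"
  assumes fin: "finite S" and wS: "w \<in> S" and e: "e > 0" and m: "m = (- e) *\<^sub>R w"
    and cone: "\<And>s. s \<in> S \<Longrightarrow> cross a s > 0 \<and> cross s b > 0"
    and D: "cross a b \<ge> 0"
    and above: "\<And>s. s \<in> S \<Longrightarrow> cross s (b - a) > cross a b"
    and max: "\<And>s. s \<in> S \<Longrightarrow> cross s (b - a) \<le> cross w (b - a)"
    and sec: "\<And>p. p \<in> convex hull (S \<union> {a, b, m}) \<Longrightarrow> cross p (b - a) = cross a b \<Longrightarrow> p \<in> convex hull {a, b}"
    and IH: "\<And>T c d n. card T < card S \<Longrightarrow> sector T c d n \<Longrightarrow> \<mu> (convex hull (T \<union> {c, d, n})) = 0"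
  shows "\<mu> (convex hull (S \<union> {a, b, m})) = 0"
proof -
  define L where "L = convex hull (S \<union> {a, b, m})"
  define l where "l p = cross p (b - a)" for p
  have lin: "linear l" unfolding l_def by (rule linear_cross)
  have lab: "l a = cross a b" "l b = cross a b" by (auto simp: l_def cross_swap[of b a])
  have lw: "l w > cross a b" "l w > 0" using above[OF wS] D by (auto simp: l_def)
  have lm: "l m < 0" using lw e by (simp add: m l_def)
  have wa: "cross w a < 0" "cross a w > 0" "cross w b > 0"
    using cone[OF wS] cross_swap[of w a] by auto
  have w0: "w \<noteq> 0" using wa by (auto simp: cross_def)
  have LP: "L \<in> polygons_o"
    unfolding L_def
  proof (rule polygons_o_superset)
    show "convex hull {w, (- e) *\<^sub>R w, b, a} \<in> polygons_o"
      using w0 e wa by (intro opposite_quad_in_polygons_o) auto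
    show "convex hull {w, (- e) *\<^sub>R w, b, a} \<subseteq> convex hull (S \<union> {a, b, m})"
      using wS by (intro hull_mono) (auto simp: m)
  qed (use fin in auto)
  have Lsub: "convex hull X \<subseteq> L" if "X \<subseteq> L" for X
    using that unfolding L_def by (simp add: hull_minimal)
  have gen: "S \<union> {a, b, m} \<subseteq> L" unfolding L_def by (rule hull_subset)
  have max': "l s \<le> l w" if "s \<in> S" for s using max[OF that] unfolding l_def .
  have above': "l s \<ge> cross a b" if "s \<in> S" for s using above[OF that] unfolding l_def by simp
  have l_le: "l p \<le> l w" if "p \<in> L" for p
    by (rule linear_sign_convex_hull(2)[OF lin, of "S \<union> {a, b, m}"])
      (use that max' lab lw lm in \<open>auto simp: L_def\<close>)
  have low: "p \<in> convex hull {a, b, m}" if p: "p \<in> L" "l p < cross a b" for p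
  proof -
    have "convex hull (S \<union> {m} \<union> {a, b}) = convex hull (S \<union> {a, b}) \<union> convex hull ({m} \<union> {a, b})"
    proof (rule convex_hull_split_across_line[OF lin])
      show "l x \<ge> cross a b" if "x \<in> S" for x using above[OF that] by (simp add: l_def)
      show "l x \<le> cross a b" if "x \<in> {m}" for x using that lm D by auto
      show "l x = cross a b" if "x \<in> {a, b}" for x using that lab by auto
      show "x \<in> convex hull {a, b}" if "x \<in> convex hull (S \<union> {m} \<union> {a, b})" "l x = cross a b" for x
        using that by (intro sec) (auto simp: l_def insert_commute)
    qed
    moreover have "S \<union> {m} \<union> {a, b} = S \<union> {a, b, m}" "{m} \<union> {a, b} = {a, b, m}" by auto
    ultimately have "L = convex hull (S \<union> {a, b}) \<union> convex hull {a, b, m}" by (simp add: L_def)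
    moreover have "l p \<ge> cross a b" if "p \<in> convex hull (S \<union> {a, b})" for p
      by (rule linear_sign_convex_hull(1)[OF lin, of "S \<union> {a, b}"])
        (use that above' lab in auto)
    ultimately show ?thesis using p by force
  qed
  have low_coords: "\<exists>i j k. 0 \<le> i \<and> 0 \<le> j \<and> 0 \<le> k \<and> i + j + k = 1 \<and> p = i *\<^sub>R a + j *\<^sub>R b + k *\<^sub>R m"
    if "p \<in> L" "l p < cross a b" for p
    using low[OF that] unfolding convex_hull_3 by blast
  have secw: "p \<in> convex hull {w, m}" if p: "p \<in> L" "cross w p = 0" for p
  proof -
    obtain k where k: "p = k *\<^sub>R w" using cross_eq_0_obtain[OF p(2) w0] .
    have lp: "l p = k * l w" by (simp add: k l_def right_diff_distrib)
    have "k \<le> 1" using l_le[OF p(1)] lw lp by simp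
    moreover have "- e \<le> k"
    proof (rule ccontr)
      assume "\<not> - e \<le> k"
      then have ke: "k < - e" by simp
      then have "k * l w < 0" using e lw by (simp add: mult_neg_pos)
      then have "l p < cross a b" using D lp by simp
      then obtain i j r where r: "0 \<le> i" "0 \<le> j" "0 \<le> r" "i + j + r = 1"
        "p = i *\<^sub>R a + j *\<^sub>R b + r *\<^sub>R m" using low_coords[OF p(1)] by blast
      \<comment> \<open>Taking \<open>cross a\<close> removes the coefficient of \<open>a\<close>
        and gives \<open>k \<ge> - r * e\<close>, against \<open>k < - e\<close>.\<close>
      have "k * cross a w = cross a p" by (simp add: k)
      also have "\<dots> = j * cross a b - r * e * cross a w" by (simp add: r(5) m)
      finally have "(k + r * e) * cross a w = j * cross a b" by (simp add: algebra_simps)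
      moreover have "j * cross a b \<ge> 0" using r D by simp
      ultimately have "(k + r * e) * cross a w \<ge> 0" by simp
      then have "k + r * e \<ge> 0" using wa(2) by (auto simp: zero_le_mult_iff)
      moreover have "r * e \<le> 1 * e" using r e by (intro mult_right_mono) auto
      ultimately show False using ke by simp
    qed
    ultimately show ?thesis unfolding k m using e by (intro in_segment_opposite) auto
  qed
  have sec_wb: "p \<in> convex hull {w, b}" if p: "p \<in> L" "cross p (b - w) = cross w b" for p
  proof -
    have "cross (b - w) (p - w) = 0" using p(2) by (simp add: cross_swap[of b] cross_swap[of w p])
    moreover have "b - w \<noteq> 0" using wa by auto
    ultimately obtain k where k: "p - w = k *\<^sub>R (b - w)" using cross_eq_0_obtain by blast
    have pe: "p = (1 - k) *\<^sub>R w + k *\<^sub>R b" using k by (simp add: algebra_simps)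
    have "l p = (1 - k) * l w + k * l b"
      by (simp only: pe linear_add[OF lin] linear_scale[OF lin] real_scaleR_def)
    then have lp: "l p = l w + k * (cross a b - l w)" by (simp add: lab algebra_simps)
    have "k \<ge> 0"
      using l_le[OF p(1)] lw lp by (simp add: mult_le_0_iff)
    moreover have "k \<le> 1"
    proof (rule ccontr)
      \<comment> \<open>Beyond \<open>b\<close> this line drops below the line of \<open>a\<close>
        and \<open>b\<close>, into the triangle with apex \<open>m\<close>, where the coefficient of
        \<open>b\<close> would have to exceed 1.\<close>
      assume k1: "\<not> k \<le> 1"
      then have "(k - 1) * (l w - cross a b) > 0" using lw by simp
      then have "l p < cross a b" using lp by (simp add: algebra_simps)
      then obtain i j r where r: "0 \<le> i" "0 \<le> j" "0 \<le> r" "i + j + r = 1"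
        "p = i *\<^sub>R a + j *\<^sub>R b + r *\<^sub>R m" using low_coords[OF p(1)] by blast
      have "k * cross w b = cross w p" by (simp add: pe)
      also have "\<dots> = i * cross w a + j * cross w b" by (simp add: r(5) m)
      also have "\<dots> \<le> j * cross w b" using r wa by (simp add: mult_nonneg_nonpos)
      finally have "k \<le> j" using wa by simp
      then show False using k1 r by simp
    qed
    ultimately show ?thesis unfolding convex_hull_2 pe
      by (intro CollectI exI[of _ "1 - k"] exI[of _ k] conjI) auto
  qed
  have sec_aw: "p \<in> convex hull {a, w}" if p: "p \<in> L" "cross p (w - a) = cross a w" for p
  proof -
    have "cross (w - a) (p - a) = 0" using p(2) by (simp add: cross_swap[of w] cross_swap[of a p])
    moreover have "w - a \<noteq> 0" using wa by auto
    ultimately obtain k where k: "p - a = k *\<^sub>R (w - a)" using cross_eq_0_obtain by blast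
    have pe: "p = (1 - k) *\<^sub>R a + k *\<^sub>R w" using k by (simp add: algebra_simps)
    have "l p = (1 - k) * l a + k * l w"
      by (simp only: pe linear_add[OF lin] linear_scale[OF lin] real_scaleR_def)
    then have lp: "l p = cross a b + k * (l w - cross a b)" by (simp add: lab algebra_simps)
    have "k \<le> 1"
    proof (rule ccontr)
      assume "\<not> k \<le> 1"
      then have "(k - 1) * (l w - cross a b) > 0" using lw by simp
      then have "l p > l w" using lp by (simp add: algebra_simps)
      then show False using l_le[OF p(1)] by simp
    qed
    moreover have "k \<ge> 0"
    proof (rule ccontr)
      assume k0: "\<not> k \<ge> 0"
      then have "k * (l w - cross a b) < 0" using lw by (simp add: mult_neg_pos)
      then have "l p < cross a b" using lp by simp
      then obtain i j r where r: "0 \<le> i" "0 \<le> j" "0 \<le> r" "i + j + r = 1"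
        "p = i *\<^sub>R a + j *\<^sub>R b + r *\<^sub>R m" using low_coords[OF p(1)] by blast
      have "i * cross w a \<le> i * cross w a + j * cross w b" using r wa by simp
      also have "\<dots> = cross w p" by (simp add: r(5) m)
      also have "\<dots> = (1 - k) * cross w a" by (simp add: pe)
      finally have "1 - k \<le> i" using wa by simp
      then show False using k0 r by simp
    qed
    ultimately show ?thesis unfolding convex_hull_2 pe
      by (intro CollectI exI[of _ "1 - k"] exI[of _ k] conjI) auto
  qed
  define Tb where "Tb = {s \<in> S. cross w s > 0}"
  define Ta where "Ta = {s \<in> S. cross w s < 0}"
  have card: "card T' < card S" if "T' \<subseteq> Tb \<or> T' \<subseteq> Ta" for T'
    using that wS fin by (intro psubset_card_mono) (auto simp: Tb_def Ta_def)
  have L_eq: "convex hull ((Tb \<union> {b}) \<union> (Ta \<union> {a}) \<union> {w, m}) = L"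
  proof (rule antisym)
    show "convex hull ((Tb \<union> {b}) \<union> (Ta \<union> {a}) \<union> {w, m}) \<subseteq> L"
      using gen wS by (intro Lsub) (auto simp: Ta_def Tb_def)
    have "s \<in> convex hull ((Tb \<union> {b}) \<union> (Ta \<union> {a}) \<union> {w, m})" if "s \<in> S" for s
    proof (cases "cross w s = 0")
      case True
      then have "s \<in> convex hull {w, m}" using that gen by (intro secw) auto
      then show ?thesis by (rule hull_mono[THEN subsetD, rotated]) auto
    next
      case False
      then show ?thesis using that by (intro hull_inc) (auto simp: Ta_def Tb_def)
    qed
    moreover have "{a, b, m} \<subseteq> convex hull ((Tb \<union> {b}) \<union> (Ta \<union> {a}) \<union> {w, m})"
      by (auto intro: hull_inc)
    ultimately show "L \<subseteq> convex hull ((Tb \<union> {b}) \<union> (Ta \<union> {a}) \<union> {w, m})"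
      unfolding L_def by (intro hull_minimal) auto
  qed
  \<comment> \<open>The caps: \<open>n1\<close> lies in the cone opposite to that of
    \<open>w\<close> and \<open>b\<close>, so these three points surround the origin; likewise
    \<open>n2\<close> for \<open>a\<close> and \<open>w\<close>.\<close>
  obtain r1 where r1: "r1 > 0" "(- r1) *\<^sub>R (w + b) \<in> L" using small_multiple_in[OF LP] .
  obtain r2 where r2: "r2 > 0" "(- r2) *\<^sub>R (a + w) \<in> L" using small_multiple_in[OF LP] .
  define n1 where "n1 = (- r1) *\<^sub>R (w + b)"
  define n2 where "n2 = (- r2) *\<^sub>R (a + w)"
  have n1: "n1 \<in> L" "cross w n1 < 0" "cross n1 b < 0" using r1 wa by (auto simp: n1_def)
  have n2: "n2 \<in> L" "cross w n2 > 0" "cross a n2 < 0" "cross n2 w < 0"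
    using r2 wa by (auto simp: n2_def mult_pos_neg)
  have "\<mu> L = \<mu> (convex hull ((Tb \<union> {b}) \<union> {n1} \<union> {w, m})) + \<mu> (convex hull ({n2} \<union> (Ta \<union> {a}) \<union> {w, m}))"
    unfolding L_eq[symmetric]
    by (rule mu_cut[OF _ _ w0 e m]; (unfold L_eq)?)
      (use fin wa secw n1 n2 in \<open>auto simp: Ta_def Tb_def\<close>)
  moreover have "(Tb \<union> {b}) \<union> {n1} \<union> {w, m} = Tb \<union> {m, n1} \<union> {w, b}"
    "{n2} \<union> (Ta \<union> {a}) \<union> {w, m} = Ta \<union> {m, n2} \<union> {a, w}" by auto
  moreover have "\<mu> (convex hull (Tb \<union> {m, n1} \<union> {w, b})) = 0"
  proof (rule mu_subsector[where L = L])
    have "\<mu> (convex hull {w, (- e) *\<^sub>R w, b, n1}) = 0"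
    proof (rule mu_opposite_quad[OF w0 e wa(3) n1(2)])
      fix p assume "p \<in> convex hull {w, (- e) *\<^sub>R w, b, n1}" "cross w p = 0"
      moreover have "{w, (- e) *\<^sub>R w, b, n1} \<subseteq> L" using gen n1 wS by (auto simp: m)
      ultimately show "p \<in> convex hull {w, (- e) *\<^sub>R w}" using secw[of p] Lsub unfolding m by blast
    qed
    moreover have "{m, n1} \<union> {w, b} = {w, (- e) *\<^sub>R w, b, n1}" by (auto simp: m)
    ultimately show "\<mu> (convex hull ({m, n1} \<union> {w, b})) = 0" by simp
    have "- (e * cross w b) \<le> 0" using e wa by simp
    then show "cross m (b - w) \<le> cross w b" using wa unfolding m by simp
    show "\<mu> (convex hull (T' \<union> {w, b, n1})) = 0" if "T' \<subseteq> Tb" "sector T' w b n1" for T'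
      using card that by (intro IH) auto
  qed (use fin wa n1 gen wS sec_wb cone in \<open>auto simp: Tb_def L_def\<close>)
  moreover have "\<mu> (convex hull (Ta \<union> {m, n2} \<union> {a, w})) = 0"
  proof (rule mu_subsector[where L = L])
    have "\<mu> (convex hull {w, (- e) *\<^sub>R w, n2, a}) = 0"
    proof (rule mu_opposite_quad[OF w0 e n2(2) wa(1)])
      fix p assume "p \<in> convex hull {w, (- e) *\<^sub>R w, n2, a}" "cross w p = 0"
      moreover have "{w, (- e) *\<^sub>R w, n2, a} \<subseteq> L" using gen n2 wS by (auto simp: m)
      ultimately show "p \<in> convex hull {w, (- e) *\<^sub>R w}" using secw[of p] Lsub unfolding m by blast
    qed
    moreover have "{m, n2} \<union> {a, w} = {w, (- e) *\<^sub>R w, n2, a}" by (auto simp: m)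
    ultimately show "\<mu> (convex hull ({m, n2} \<union> {a, w})) = 0" by simp
    have "e * cross w a \<le> 0" using e wa by (simp add: mult_pos_neg less_imp_le)
    then show "cross m (w - a) \<le> cross a w" using wa unfolding m by simp
    show "\<mu> (convex hull (T' \<union> {a, w, n2})) = 0" if "T' \<subseteq> Ta" "sector T' a w n2" for T'
      using card that by (intro IH) auto
    show "cross a s > 0 \<and> cross s w > 0" if "s \<in> Ta" for s
      using that cone cross_swap[of s w] by (auto simp: Ta_def)
  qed (use fin wa n2 gen wS sec_aw in \<open>auto simp: Ta_def L_def\<close>)
  ultimately show ?thesis unfolding L_def by simp
qed

text \<open>Before the fan is cut, \<open>mu_bottom\<close> trades \<open>n\<close> for a point
  \<open>m\<close> opposite to the farthest point \<open>w\<close>, so that the cut through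
  \<open>w\<close> and the origin ends at a vertex. A small multiple keeps \<open>m\<close> inside
  the triangle.\<close>

lemma mu_sector: "sector S a b n \<Longrightarrow> \<mu> (convex hull (S \<union> {a, b, n})) = 0"
proof (induction "card S" arbitrary: S a b n rule: less_induct)
  case less
  then have sec: "finite S" "cross a b > 0" "cross a n < 0" "cross n b < 0"
    "\<And>s. s \<in> S \<Longrightarrow> cross a s > 0 \<and> cross s b > 0 \<and> cross s (b - a) > cross a b"
    "\<And>p. p \<in> convex hull (S \<union> {a, b, n}) \<Longrightarrow> cross p (b - a) = cross a b \<Longrightarrow> p \<in> convex hull {a, b}"
    unfolding sector_def by auto
  show ?case
  proof (cases "S = {}")
    case True
    then show ?thesis using mu_cone_triangle[OF sec(2-4)] by simp
  next
    case False
    define l where "l p = cross p (b - a)" for p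
    have "Max (l ` S) \<in> l ` S" using sec(1) False by (intro Max_in) auto
    then obtain w where w: "w \<in> S" "l w = Max (l ` S)" by auto
    have max: "l s \<le> l w" if "s \<in> S" for s using that sec(1) unfolding w(2) by (intro Max_ge) auto
    obtain e where e: "e > 0" "(- e) *\<^sub>R w \<in> convex hull {a, b, n}"
      using small_multiple_in[OF cone_triangle_in_polygons_o[OF sec(2-4)]] .
    define m where "m = (- e) *\<^sub>R w"
    have am: "cross a m < 0" "cross m b < 0" using e sec(5)[OF w(1)] by (auto simp: m_def)
    have abx: "S \<union> {a, b, x} = S \<union> {x} \<union> {a, b}" "{a, b, x} = {x} \<union> {a, b}" for x by auto
    have "\<mu> (convex hull (S \<union> {n} \<union> {a, b})) = \<mu> (convex hull (S \<union> {m} \<union> {a, b}))"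
    proof (rule mu_bottom)
      show "convex hull ({m} \<union> {a, b}) \<in> polygons_o"
        using cone_triangle_in_polygons_o[OF sec(2) am] unfolding abx(2) .
      show "\<mu> (convex hull ({m} \<union> {a, b})) = 0" "\<mu> (convex hull ({n} \<union> {a, b})) = 0"
        using mu_cone_triangle[OF sec(2) am] mu_cone_triangle[OF sec(2-4)] unfolding abx(2) by auto
      show "{m} \<subseteq> convex hull ({n} \<union> {a, b})"
        using e(2) unfolding abx(2) m_def by simp
      show "p \<in> convex hull {a, b}"
        if "p \<in> convex hull (S \<union> {n} \<union> {a, b})" "cross p (b - a) = cross a b" for p
        using that by (intro sec(6)) (simp_all only: abx(1))
      show "cross p (b - a) \<le> cross a b" if "p \<in> {n}" for p
        using that sec(2-4) by (simp add: cross_swap[of n a])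
    qed (use sec in \<open>auto intro: less_imp_le\<close>)
    also have "\<mu> (convex hull (S \<union> {a, b, m})) = 0"
    proof (rule mu_fan[OF sec(1) w(1) e(1) m_def])
      have "convex hull (S \<union> {a, b, m}) \<subseteq> convex hull (S \<union> {a, b, n})"
      proof (rule hull_minimal)
        have "m \<in> convex hull (S \<union> {a, b, n})"
          using e(2) unfolding m_def by (rule hull_mono[THEN subsetD, rotated]) auto
        then show "S \<union> {a, b, m} \<subseteq> convex hull (S \<union> {a, b, n})" by (auto intro: hull_inc)
      qed auto
      then show "p \<in> convex hull {a, b}"
        if "p \<in> convex hull (S \<union> {a, b, m})" "cross p (b - a) = cross a b" for p
        using that sec(6) by blast
    qed (use sec max less(1) in \<open>auto simp: l_def\<close>)
    then have "\<mu> (convex hull (S \<union> {m} \<union> {a, b})) = 0" unfolding abx(1) .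
    finally show ?thesis unfolding abx(1) .
  qed
qed

text \<open>The degenerate case of \<open>mu_fan\<close> in which the base passes through the
  origin; a point opposite to the farthest point of \<open>X\<close> caps the half.\<close>

lemma mu_half:
  assumes P: "P \<in> polygons_o" and X: "finite X" "X \<noteq> {}" and e: "e > 0" and b: "b = (- e) *\<^sub>R a"
    and pos: "\<And>s. s \<in> X \<Longrightarrow> cross a s > 0" and sub: "X \<union> {a, b} \<subseteq> P"
    and sec: "\<And>p. p \<in> P \<Longrightarrow> cross a p = 0 \<Longrightarrow> p \<in> convex hull {a, b}"
  shows "\<exists>n\<in>P. cross a n < 0 \<and> \<mu> (convex hull (X \<union> {a, b, n})) = 0"
proof -
  have l: "cross p (b - a) = (1 + e) * cross a p" for p
    by (simp add: b cross_swap[of p a] algebra_simps)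
  have "Max (cross a ` X) \<in> cross a ` X" using X by (intro Max_in) auto
  then obtain w where w: "w \<in> X" "cross a w = Max (cross a ` X)" by auto
  have max: "cross a s \<le> cross a w" if "s \<in> X" for s
    using that X(1) unfolding w(2) by (intro Max_ge) auto
  obtain r where r: "r > 0" "(- r) *\<^sub>R w \<in> P" using small_multiple_in[OF P] .
  have "\<mu> (convex hull (X \<union> {a, b, (- r) *\<^sub>R w})) = 0"
  proof (rule mu_fan[OF X(1) w(1) r(1) refl])
    show "cross a s > 0 \<and> cross s b > 0" if "s \<in> X" for s
      using pos[OF that] e by (simp add: b cross_swap[of s a])
    show "0 \<le> cross a b" by (simp add: b)
    show "cross a b < cross s (b - a)" if "s \<in> X" for s
      unfolding l using pos[OF that] e by (simp add: b)
    show "cross s (b - a) \<le> cross w (b - a)" if "s \<in> X" for s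
      unfolding l using max[OF that] e by (intro mult_left_mono) auto
    show "p \<in> convex hull {a, b}"
      if "p \<in> convex hull (X \<union> {a, b, (- r) *\<^sub>R w})" "cross p (b - a) = cross a b" for p
    proof (rule sec)
      have "convex hull (X \<union> {a, b, (- r) *\<^sub>R w}) \<subseteq> P"
        using sub r polygons_o_convex[OF P] by (intro hull_minimal) auto
      then show "p \<in> P" using that by auto
      show "cross a p = 0" using that(2) e unfolding l by (simp add: b)
    qed
  qed (use mu_sector in auto)
  moreover have "cross a ((- r) *\<^sub>R w) < 0" using r pos[OF w(1)] by simp
  ultimately show ?thesis using r by blast
qed

lemma mu_null:
  assumes "P \<in> polygons_o"
  shows "\<mu> P = 0"
proof -
  obtain S where S: "finite S" "P = convex hull S" and "0 \<in> interior P"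
    using assms unfolding polygons_o_def by auto
  have "S \<noteq> {}" using S \<open>0 \<in> interior P\<close> by auto
  \<comment> \<open>A vertex of maximal norm is the end of the section of \<open>P\<close> with its
    line through the origin.\<close>
  have "Max (norm ` S) \<in> norm ` S" using S \<open>S \<noteq> {}\<close> by (intro Max_in) auto
  then obtain v where v: "v \<in> S" "norm v = Max (norm ` S)" by auto
  have "S \<subseteq> cball 0 (norm v)" using S(1) unfolding v(2) by auto
  then have P_norm: "P \<subseteq> cball 0 (norm v)" unfolding S(2) by (intro hull_minimal) auto
  have "v \<noteq> 0"
  proof
    assume "v = 0"
    then have "interior P \<subseteq> interior {0}" using P_norm by (intro interior_mono) auto
    then show False using \<open>0 \<in> interior P\<close> by simp
  qed
  have P: "compact P" "convex P" using assms by (auto simp: polygons_o_altdef polytope_imp_compact polytope_imp_convex)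
  \<comment> \<open>The largest element of \<open>T\<close> gives the other end \<open>b\<close> of
    that section, which need not be in \<open>S\<close>.\<close>
  define T where "T = (\<lambda>k. (- k) *\<^sub>R v) -` P"
  have "closed T"
    unfolding T_def using P(1) by (intro closed_vimage compact_imp_closed continuous_intros)
  moreover have Tb: "\<bar>k\<bar> \<le> 1" if "k \<in> T" for k
  proof -
    have "norm ((- k) *\<^sub>R v) \<le> norm v" using that P_norm by (auto simp: T_def)
    then show ?thesis using \<open>v \<noteq> 0\<close> by simp
  qed
  then have "bounded T" by (auto simp: bounded_iff)
  ultimately have "compact T" by (simp add: compact_eq_bounded_closed)
  obtain e0 where e0: "e0 > 0" "e0 \<in> T" using small_multiple_in[OF assms, of v] by (auto simp: T_def)
  then obtain e where e: "e \<in> T" "\<And>k. k \<in> T \<Longrightarrow> k \<le> e"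
    using compact_attains_sup[OF \<open>compact T\<close>] by blast
  have e_pos: "e > 0" using e(2)[OF e0(2)] e0(1) by simp
  define b where "b = (- e) *\<^sub>R v"
  have bP: "b \<in> P" using e(1) by (simp add: T_def b_def)
  have sec: "p \<in> convex hull {v, b}" if p: "p \<in> P" "cross v p = 0" for p
  proof -
    obtain k where k: "p = k *\<^sub>R v" using cross_eq_0_obtain[OF p(2) \<open>v \<noteq> 0\<close>] .
    have "norm p \<le> norm v" using p P_norm by auto
    then have "k \<le> 1" using \<open>v \<noteq> 0\<close> by (simp add: k)
    moreover have "- k \<le> e" using p(1) by (intro e(2)) (simp add: T_def k)
    ultimately show ?thesis unfolding k b_def using e_pos by (intro in_segment_opposite) auto
  qed
  define A where "A = {s \<in> S. cross v s > 0}"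
  define B where "B = {s \<in> S. cross v s < 0}"
  have fin: "finite A" "finite B" using S(1) by (auto simp: A_def B_def)
  have SP: "S \<subseteq> P" unfolding S(2) by (rule hull_subset)
  have sub: "convex hull X \<subseteq> P" if "X \<subseteq> P" for X using that P(2) by (rule hull_minimal)
  have P_eq: "convex hull (A \<union> B \<union> {v, b}) = P"
  proof (rule antisym)
    show "convex hull (A \<union> B \<union> {v, b}) \<subseteq> P"
      using SP bP v(1) by (intro sub) (auto simp: A_def B_def)
    have "s \<in> convex hull (A \<union> B \<union> {v, b})" if "s \<in> S" for s
    proof (cases "cross v s = 0")
      case True
      then have "s \<in> convex hull {v, b}" using that SP by (intro sec) auto
      then show ?thesis by (rule hull_mono[THEN subsetD, rotated]) auto
    next
      case False
      then show ?thesis using that by (intro hull_inc) (auto simp: A_def B_def)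
    qed
    then show "P \<subseteq> convex hull (A \<union> B \<union> {v, b})"
      unfolding S(2) by (intro hull_minimal) auto
  qed
  define q where "q = pnt (- v$2) (v$1)"
  have vq: "cross v q > 0"
    using \<open>v \<noteq> 0\<close> by (auto simp: q_def cross_def pt_eq_iff power2_eq_square[symmetric] sum_power2_gt_zero_iff)
  have "A \<noteq> {}"
  proof
    assume "A = {}"
    then have le: "cross v p \<le> 0" if "p \<in> P" for p
      using that linear_sign_convex_hull(2)[OF linear_cross(1), of S v 0 p]
      unfolding S(2) A_def by force
    obtain r where "r > 0" "(- r) *\<^sub>R (- q) \<in> P" using small_multiple_in[OF assms] .
    then show False using vq le[of "(- r) *\<^sub>R (- q)"] by (auto simp: mult_le_0_iff)
  qed
  have "B \<noteq> {}"
  proof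
    assume "B = {}"
    then have ge: "cross v p \<ge> 0" if "p \<in> P" for p
      using that linear_sign_convex_hull(1)[OF linear_cross(1), of S 0 v p]
      unfolding S(2) B_def by force
    obtain r where "r > 0" "(- r) *\<^sub>R q \<in> P" using small_multiple_in[OF assms] .
    then show False using vq ge[of "(- r) *\<^sub>R q"] by (auto simp: mult_le_0_iff)
  qed
  obtain n1 where n1: "n1 \<in> P" "cross v n1 < 0" "\<mu> (convex hull (A \<union> {v, b, n1})) = 0"
  proof -
    have "\<exists>n\<in>P. cross v n < 0 \<and> \<mu> (convex hull (A \<union> {v, b, n})) = 0"
      using SP v(1) bP sec by (intro mu_half[OF assms fin(1) \<open>A \<noteq> {}\<close> e_pos b_def]) (auto simp: A_def)
    then show ?thesis using that by blast
  qed
  obtain n2 where n2: "n2 \<in> P" "cross v n2 > 0" "\<mu> (convex hull (B \<union> {b, v, n2})) = 0"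
  proof -
    \<comment> \<open>Interchanging the ends of the diagonal makes the negative side positive, so
      that \<open>mu_half\<close> applies to \<open>B\<close>.\<close>
    have bv: "v = (- (1 / e)) *\<^sub>R b" using e_pos by (simp add: b_def)
    have cb: "cross b p = - (e * cross v p)" for p by (simp add: b_def)
    have "\<exists>n\<in>P. cross b n < 0 \<and> \<mu> (convex hull (B \<union> {b, v, n})) = 0"
    proof (rule mu_half[OF assms fin(2) \<open>B \<noteq> {}\<close> _ bv])
      show "p \<in> convex hull {b, v}" if "p \<in> P" "cross b p = 0" for p
        using sec[of p] that e_pos by (simp add: cb insert_commute)
    qed (use SP v(1) bP e_pos in \<open>auto simp: B_def cb mult_pos_neg\<close>)
    then show ?thesis using that e_pos by (auto simp: cb zero_less_mult_iff)
  qed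
  have "\<mu> P = \<mu> (convex hull (A \<union> {n1} \<union> {v, b})) + \<mu> (convex hull ({n2} \<union> B \<union> {v, b}))"
    unfolding P_eq[symmetric]
    by (rule mu_cut[OF fin \<open>v \<noteq> 0\<close> e_pos b_def]; (unfold P_eq)?)
      (use sec n1 n2 in \<open>auto simp: A_def B_def\<close>)
  moreover have "A \<union> {n1} \<union> {v, b} = A \<union> {v, b, n1}" "{n2} \<union> B \<union> {v, b} = B \<union> {b, v, n2}" by auto
  ultimately show ?thesis using n1 n2 by simp
qed

end

section \<open>The moment vector and measurability\<close>

lemma id_absolutely_integrable_on_compact:
  fixes P :: "'a::euclidean_space set"
  assumes "compact P"
  shows "(\<lambda>x. x) absolutely_integrable_on P"
proof -
  have "integrable lborel (\<lambda>x. indicator P x *\<^sub>R x)"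
    using assms by (intro borel_integrable_compact continuous_intros)
  then show ?thesis
    unfolding set_integrable_def by (simp add: integrable_completion borel_measurable_integrable)
qed

lemma polygons_o_integrable: "P \<in> polygons_o \<Longrightarrow> (\<lambda>x::pt. x) absolutely_integrable_on P"
  by (intro id_absolutely_integrable_on_compact) (simp add: polygons_o_altdef polytope_imp_compact)

lemma polygons_o_has_integral:
  assumes "P \<in> polygons_o"
  shows "((\<lambda>x::pt. if x \<in> P then x else 0) has_integral moment_vector P) UNIV"
  using set_lebesgue_integral_eq_integral(1)[OF polygons_o_integrable[OF assms]]
  unfolding has_integral_restrict_UNIV moment_vector_def by (rule integrable_integral)

lemma covariant_valuation_moment_vector: "covariant_valuation moment_vector"
proof
  show "is_valuation polygons_o moment_vector"
    unfolding is_valuation_def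
  proof (intro ballI impI)
    fix K L assume P: "K \<in> polygons_o" "L \<in> polygons_o" "K \<union> L \<in> polygons_o" "K \<inter> L \<in> polygons_o"
    have "((\<lambda>x::pt. (if x \<in> K \<union> L then x else 0) + (if x \<in> K \<inter> L then x else 0))
        has_integral moment_vector (K \<union> L) + moment_vector (K \<inter> L)) UNIV"
      using P by (intro has_integral_add polygons_o_has_integral)
    also have "(\<lambda>x::pt. (if x \<in> K \<union> L then x else 0) + (if x \<in> K \<inter> L then x else 0))
        = (\<lambda>x. (if x \<in> K then x else 0) + (if x \<in> L then x else 0))" by auto
    finally show "moment_vector (K \<union> L) + moment_vector (K \<inter> L) = moment_vector K + moment_vector L"
      by (rule has_integral_unique) (use P in \<open>intro has_integral_add polygons_o_has_integral\<close>)
  qed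
next
  fix P A assume P: "P \<in> polygons_o" and A: "A \<in> VL2"
  have "integral ((*v) A ` P) (\<lambda>x. x) = \<bar>det (matrix ((*v) A))\<bar> *\<^sub>R integral P ((\<lambda>x. x) \<circ> (*v) A)"
    using polygons_o_integrable[OF polygons_o_imageI[OF P A]]
    by (intro integral_change_of_variables_linear) auto
  also have "\<bar>det (matrix ((*v) A))\<bar> = 1" using A by (auto simp: VL2_def)
  also have "integral P ((\<lambda>x. x) \<circ> (*v) A) = A *v integral P (\<lambda>x. x)"
    using integral_linear[OF set_lebesgue_integral_eq_integral(1)[OF polygons_o_integrable[OF P]],
        of "(*v) A"] by (simp add: o_def)
  finally show "moment_vector ((*v) A ` P) = A *v moment_vector P"
    by (simp add: moment_vector_def)
qed

section \<open>Dependence of the unit kites on their right vertex\<close>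

abbreviation unit_kite :: "real \<Rightarrow> pt set" where
  "unit_kite x \<equiv> kite x 1 0 1 0 1"

lemma unit_kite_eq: "unit_kite x = convex hull {pnt x 0, pnt (-1) 0, pnt 0 1, pnt 0 (-1)}"
  by (simp add: kite_def quad_def)

lemma unit_kite_mono:
  assumes "0 < x" "x \<le> y"
  shows "unit_kite x \<subseteq> unit_kite y"
  unfolding unit_kite_eq[of x]
proof (rule hull_minimal)
  have "pnt x 0 \<in> convex hull {pnt y 0, pnt (-1) 0}"
    using assms by (intro segment_on_axis) auto
  then have "pnt x 0 \<in> unit_kite y"
    unfolding unit_kite_eq by (rule hull_mono[THEN subsetD, rotated]) auto
  then show "{pnt x 0, pnt (-1) 0, pnt 0 1, pnt 0 (-1)} \<subseteq> unit_kite y"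
    unfolding unit_kite_eq by (auto intro: hull_inc)
qed (simp add: unit_kite_eq)

text \<open>Left of the vertical axis all these kites are the same triangle. Hence moving the right
  vertex outwards adds only points with nonnegative first coordinate, which makes the first moment
  monotone.\<close>

lemma unit_kite_negative_half:
  assumes "0 < x" "0 < y" "p \<in> unit_kite y" "p$1 < 0"
  shows "p \<in> unit_kite x"
proof -
  let ?C = "{pnt 0 1, pnt 0 (-1)}"
  have "convex hull ({pnt y 0} \<union> {pnt (-1) 0} \<union> ?C) = convex hull ({pnt y 0} \<union> ?C) \<union> convex hull ({pnt (-1) 0} \<union> ?C)"
  proof (rule convex_hull_split_across_line[where c = 0, OF linear_coord[of 1]])
    fix q assume q: "q \<in> convex hull ({pnt y 0} \<union> {pnt (-1) 0} \<union> ?C)" "q$1 = 0"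
    have "q$2 \<le> 1" "q$2 \<ge> -1"
      by (rule linear_sign_convex_hull[OF linear_coord, OF _ q(1)]; auto)+
    then have "q$2 *\<^sub>R pnt 0 1 \<in> convex hull {pnt 0 1, (- 1) *\<^sub>R pnt 0 1}"
      by (intro in_segment_opposite) auto
    moreover have "q$2 *\<^sub>R pnt 0 1 = q" "(- 1) *\<^sub>R pnt 0 1 = pnt 0 (-1)"
      using q(2) by (auto simp: pt_eq_iff)
    ultimately show "q \<in> convex hull ?C" by simp
  qed (use assms in auto)
  moreover have "{pnt y 0} \<union> {pnt (-1) 0} \<union> ?C = {pnt y 0, pnt (-1) 0, pnt 0 1, pnt 0 (-1)}" by auto
  ultimately have "p \<in> convex hull ({pnt y 0} \<union> ?C) \<union> convex hull ({pnt (-1) 0} \<union> ?C)"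
    using assms(3) unfolding unit_kite_eq by simp
  moreover have "p \<notin> convex hull ({pnt y 0} \<union> ?C)"
  proof
    assume "p \<in> convex hull ({pnt y 0} \<union> ?C)"
    then have "p$1 \<ge> 0"
      by (rule linear_sign_convex_hull(1)[OF linear_coord, rotated]) (use assms in auto)
    then show False using assms(4) by simp
  qed
  ultimately have "p \<in> convex hull ({pnt (-1) 0} \<union> ?C)" by simp
  then show ?thesis unfolding unit_kite_eq by (rule hull_mono[THEN subsetD, rotated]) auto
qed

lemma unit_kite_in_polygons_o: "x > 0 \<Longrightarrow> unit_kite x \<in> polygons_o"
  by (rule kite_in_polygons_o) auto

lemma moment_unit_kite_diff:
  assumes "0 < x" "0 < y"
  shows "((\<lambda>p::pt. (if p \<in> unit_kite y then p$1 else 0) - (if p \<in> unit_kite x then p$1 else 0))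
    has_integral (moment_vector (unit_kite y) $ 1 - moment_vector (unit_kite x) $ 1)) UNIV"
proof -
  have "((\<lambda>p::pt. (if p \<in> unit_kite x then p$1 else 0)) has_integral moment_vector (unit_kite x) $ 1) UNIV"
    if "0 < x" for x
  proof -
    have "((\<lambda>p. (if p \<in> unit_kite x then p else 0) $ 1) has_integral moment_vector (unit_kite x) $ 1) UNIV"
      using has_integral_linear[OF polygons_o_has_integral[OF unit_kite_in_polygons_o[OF that]],
          OF bounded_linear_vec_nth, of 1] by (simp add: o_def)
    moreover have "(\<lambda>p::pt. (if p \<in> unit_kite x then p else 0) $ 1) = (\<lambda>p. if p \<in> unit_kite x then p$1 else 0)"
      by auto
    ultimately show ?thesis by simp
  qed
  then show ?thesis using assms by (intro has_integral_diff)
qed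

lemma moment_unit_kite_mono:
  assumes "0 < x" "x \<le> y"
  shows "moment_vector (unit_kite x) $ 1 \<le> moment_vector (unit_kite y) $ 1"
proof -
  have "0 \<le> moment_vector (unit_kite y) $ 1 - moment_vector (unit_kite x) $ 1"
  proof (rule has_integral_nonneg[OF moment_unit_kite_diff])
    fix p :: pt
    show "0 \<le> (if p \<in> unit_kite y then p$1 else 0) - (if p \<in> unit_kite x then p$1 else 0)"
      using unit_kite_mono[OF assms] unit_kite_negative_half[of x y p] assms by force
  qed (use assms in auto)
  then show ?thesis by simp
qed

text \<open>This yields a nonzero factor for the moment vector without evaluating the integral: on a
  box inside the larger kite and to the right of the smaller one the first coordinate exceeds 1, so
  the moments differ at least by its area.\<close>

lemma moment_unit_kite_strict: "moment_vector (unit_kite 1) $ 1 < moment_vector (unit_kite 2) $ 1"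
proof -
  \<comment> \<open>Up to first coordinate 7/5 the larger kite still reaches height 3/10, so the box
    fits.\<close>
  define B where "B = cbox (pnt (6/5) (- 1/10)) (pnt (7/5) (1/10))"
  have BD: "6/5 \<le> p$1 \<and> p$1 \<le> 7/5 \<and> - 1/10 \<le> p$2 \<and> p$2 \<le> 1/10" if "p \<in> B" for p
    using that by (auto simp: B_def mem_box_cart forall_2)
  have B2: "p \<in> unit_kite 2" if "p \<in> B" for p
  proof -
    have "p = (p$1 / 2) *\<^sub>R pnt 2 0 + ((1 - p$1 / 2 + p$2) / 2) *\<^sub>R pnt 0 1
        + ((1 - p$1 / 2 - p$2) / 2) *\<^sub>R pnt 0 (-1)"
      by (simp add: pt_eq_iff field_simps)
    then have "p \<in> convex hull {pnt 2 0, pnt 0 1, pnt 0 (-1)}"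
      unfolding convex_hull_3 using BD[OF that]
      by (intro CollectI exI[of _ "p$1 / 2"] exI[of _ "(1 - p$1 / 2 + p$2) / 2"]
          exI[of _ "(1 - p$1 / 2 - p$2) / 2"] conjI) (auto simp: field_simps)
    then show ?thesis unfolding unit_kite_eq by (rule hull_mono[THEN subsetD, rotated]) auto
  qed
  have B1: "p \<notin> unit_kite 1" if "p \<in> B" for p
  proof
    assume "p \<in> unit_kite 1"
    then have "p$1 \<le> 1"
      unfolding unit_kite_eq by (rule linear_sign_convex_hull(2)[OF linear_coord, rotated]) auto
    then show False using BD[OF that] by simp
  qed
  have "measure lebesgue B \<noteq> 0"
  proof -
    have "pnt (13/10) 0 \<in> interior B"
      by (simp add: B_def interior_cbox mem_box_cart forall_2)
    then show ?thesis unfolding B_def using content_eq_0_interior by fastforce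
  qed
  then have "measure lebesgue B > 0" by (simp add: zero_less_measure_iff)
  moreover have "((\<lambda>p. if p \<in> B then 1 else 0) has_integral measure lebesgue B) UNIV"
    using has_integral_const[of "1::real" "pnt (6/5) (- 1/10)" "pnt (7/5) (1/10)"]
    unfolding has_integral_restrict_UNIV B_def by simp
  then have "measure lebesgue B \<le> moment_vector (unit_kite 2) $ 1 - moment_vector (unit_kite 1) $ 1"
  proof (rule has_integral_le[OF _ moment_unit_kite_diff])
    fix p :: pt
    show "(if p \<in> B then 1 else 0) \<le> (if p \<in> unit_kite 2 then p$1 else 0) - (if p \<in> unit_kite 1 then p$1 else 0)"
      using B1[of p] B2[of p] BD[of p] unit_kite_mono[of 1 2] unit_kite_negative_half[of 1 2 p] by force
  qed auto
  ultimately show ?thesis by simp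
qed

text \<open>Moving the right vertex with the convex weights kept displaces each point by at most the
  distance of the two vertices.\<close>

lemma hausdorff_unit_kite:
  assumes "0 < x" "0 < y"
  shows "hausdorff_dist (unit_kite x) (unit_kite y) \<le> \<bar>x - y\<bar>"
proof -
  have *: "infdist p (unit_kite y) \<le> \<bar>x - y\<bar>" if p: "p \<in> unit_kite x" for p x y
  proof -
    let ?R = "{pnt (-1) 0, pnt 0 1, pnt 0 (-1)}"
    have hull: "unit_kite z = {(1 - u) *\<^sub>R pnt z 0 + u *\<^sub>R q | q u. 0 \<le> u \<and> u \<le> 1 \<and> q \<in> convex hull ?R}" for z
      unfolding unit_kite_eq using convex_hull_insert_alt[of "pnt z 0" ?R] by simp
    obtain u q where u: "0 \<le> u" "u \<le> 1" "q \<in> convex hull ?R" "p = (1 - u) *\<^sub>R pnt x 0 + u *\<^sub>R q"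
      using p unfolding hull by blast
    define p' where "p' = (1 - u) *\<^sub>R pnt y 0 + u *\<^sub>R q"
    have "p' \<in> unit_kite y"
      unfolding hull p'_def using u by blast
    moreover have "dist p p' \<le> \<bar>x - y\<bar>"
    proof -
      have "p - p' = ((1 - u) * (x - y)) *\<^sub>R axis 1 1"
        by (simp add: u(4) p'_def pt_eq_iff axis_def algebra_simps)
      then have "dist p p' = (1 - u) * \<bar>x - y\<bar>"
        using u by (simp add: dist_norm abs_mult)
      also have "\<dots> \<le> 1 * \<bar>x - y\<bar>" using u by (intro mult_right_mono) auto
      finally show ?thesis by simp
    qed
    ultimately show ?thesis using infdist_le order_trans by blast
  qed
  have "pnt 0 1 \<in> unit_kite x" for x unfolding unit_kite_eq by (auto intro: hull_inc)
  then have ne: "unit_kite x \<noteq> {}" for x by blast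
  show ?thesis
    unfolding hausdorff_dist_def using *[of _ x y] *[of _ y x] ne
    by (auto intro!: cSUP_least max.boundedI simp: abs_minus_commute)
qed

text \<open>The default 1 for nonpositive \<open>x\<close> keeps all values in
  \<open>polygons_o\<close>. The preimage of an open family is then an open set, by continuity on
  the positive half-line, with or without the half-line \<open>{..0}\<close>.\<close>

lemma measurable_unit_kite:
  "(\<lambda>x. unit_kite (if x > 0 then x else 1)) \<in> measurable borel polygons_o_borel"
  unfolding polygons_o_borel_def
proof (rule measurable_measure_of)
  show "hausdorff_open_sets \<subseteq> Pow polygons_o" by (auto simp: hausdorff_open_sets_def)
  show "(\<lambda>x. unit_kite (if x > 0 then x else 1)) \<in> space borel \<rightarrow> polygons_o"
    by (auto intro: unit_kite_in_polygons_o)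
  fix U assume U: "U \<in> hausdorff_open_sets"
  have "open {x. 0 < x \<and> unit_kite x \<in> U}"
    unfolding open_dist
  proof (intro ballI)
    fix x assume x: "x \<in> {x. 0 < x \<and> unit_kite x \<in> U}"
    then obtain e where e: "e > 0" "\<And>Q. Q \<in> polygons_o \<Longrightarrow> hausdorff_dist (unit_kite x) Q < e \<Longrightarrow> Q \<in> U"
      using U unfolding hausdorff_open_sets_def by blast
    have "unit_kite y \<in> U \<and> y > 0" if "dist y x < min e x" for y
    proof -
      have y: "y > 0" "\<bar>x - y\<bar> < e" using that by (auto simp: dist_real_def)
      then show ?thesis
        using x hausdorff_unit_kite[of x y] by (auto intro!: e(2) unit_kite_in_polygons_o)
    qed
    then show "\<exists>e>0. \<forall>y. dist y x < e \<longrightarrow> y \<in> {x. 0 < x \<and> unit_kite x \<in> U}"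
      using x e(1) by (intro exI[of _ "min e x"]) auto
  qed
  moreover have "(\<lambda>x. unit_kite (if x > 0 then x else 1)) -` U \<inter> space borel
      = {x. 0 < x \<and> unit_kite x \<in> U} \<union> (if unit_kite 1 \<in> U then {..0} else {})"
  proof (rule set_eqI)
    show "x \<in> (\<lambda>x. unit_kite (if x > 0 then x else 1)) -` U \<inter> space borel \<longleftrightarrow>
        x \<in> {x. 0 < x \<and> unit_kite x \<in> U} \<union> (if unit_kite 1 \<in> U then {..0} else {})" for x
      by (cases "x > 0") simp_all
  qed
  ultimately show "(\<lambda>x. unit_kite (if x > 0 then x else 1)) -` U \<inter> space borel \<in> sets borel"
    by auto
qed

theorem theorem3p8:
  fixes \<mu> :: "pt set \<Rightarrow> pt"
  assumes "\<mu> \<in> measurable polygons_o_borel borel"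
    and "is_valuation polygons_o \<mu>"
    and "\<And>P A. P \<in> polygons_o \<Longrightarrow> A \<in> VL2 \<Longrightarrow> \<mu> ((\<lambda>x. A *v x) ` P) = A *v \<mu> P"
  shows "\<exists>k::real. \<forall>P\<in>polygons_o. \<mu> P = k *\<^sub>R moment_vector P"
proof -
  interpret M: covariant_valuation \<mu> using assms(2,3) by unfold_locales auto
  interpret m: covariant_valuation moment_vector by (rule covariant_valuation_moment_vector)
  define g where "g x = \<mu> (unit_kite (if x > 0 then x else 1))" for x
  have "g \<in> borel_measurable borel"
    unfolding g_def by (rule measurable_compose[OF measurable_unit_kite assms(1)])
  moreover have "(\<lambda>v::pt. v$1) \<in> borel_measurable borel"
    by (intro borel_measurable_continuous_onI linear_continuous_on bounded_linear_vec_nth)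
  ultimately have [measurable]: "(\<lambda>x. g x $ 1) \<in> borel_measurable borel"
    by (rule measurable_compose)
  have "(\<lambda>x. if x > 0 then g x $ 1 else 0) \<in> borel_measurable borel"
    by measurable
  also have "(\<lambda>x. if x > 0 then g x $ 1 else 0) = (\<lambda>x. if x > 0 then M.f x else 0)"
    by (simp add: fun_eq_iff M.f_def g_def)
  finally obtain k1 where k1: "\<And>x. x > 0 \<Longrightarrow> M.f x = k1 * (x\<^sup>2 - 1)"
    using M.f_quadratic by blast
  \<comment> \<open>For the moment vector, monotonicity supplies the measurability of
    \<open>f\<close>.\<close>
  have "mono_on {0<..} m.f"
    by (auto simp: m.f_def intro!: mono_onI moment_unit_kite_mono)
  then have "m.f \<in> borel_measurable (restrict_space borel {0<..})"
    by (rule borel_measurable_mono_on_fnc)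
  then have "(\<lambda>x. indicator {0<..} x *\<^sub>R m.f x) \<in> borel_measurable borel"
    by (subst (asm) borel_measurable_restrict_space_iff) auto
  also have "(\<lambda>x. indicator {0<..} x *\<^sub>R m.f x) = (\<lambda>x. if x > 0 then m.f x else 0)"
    by (auto simp: fun_eq_iff)
  finally obtain k2 where k2: "\<And>x. x > 0 \<Longrightarrow> m.f x = k2 * (x\<^sup>2 - 1)"
    using m.f_quadratic by blast
  have "m.f 1 < m.f 2" using moment_unit_kite_strict by (simp add: m.f_def)
  then have "k2 \<noteq> 0" using k2[of 2] m.f_one by auto
  \<comment> \<open>With this factor the function \<open>f\<close> of the difference is
    \<open>(k1 - k * k2) * (x\<^sup>2 - 1) = 0\<close>.\<close>
  define k where "k = k1 / k2"
  define \<nu> where "\<nu> P = \<mu> P - k *\<^sub>R moment_vector P" for P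
  interpret N: covariant_valuation \<nu>
  proof
    show "is_valuation polygons_o \<nu>"
      unfolding is_valuation_def
    proof (intro ballI impI)
      fix K L assume P: "K \<in> polygons_o" "L \<in> polygons_o" "K \<union> L \<in> polygons_o"
      have "\<nu> (K \<union> L) + \<nu> (K \<inter> L)
          = (\<mu> (K \<union> L) + \<mu> (K \<inter> L)) - k *\<^sub>R (moment_vector (K \<union> L) + moment_vector (K \<inter> L))"
        by (simp add: \<nu>_def algebra_simps)
      also have "\<dots> = \<nu> K + \<nu> L"
        unfolding M.valuationD[OF P] m.valuationD[OF P] by (simp add: \<nu>_def algebra_simps)
      finally show "\<nu> (K \<union> L) + \<nu> (K \<inter> L) = \<nu> K + \<nu> L" .
    qed
    show "\<nu> ((\<lambda>x. A *v x) ` P) = A *v \<nu> P" if "P \<in> polygons_o" "A \<in> VL2" for P A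
      using M.covariant[OF that] m.covariant[OF that]
      by (simp add: \<nu>_def matrix_vector_mult_diff_distrib matrix_vector_mult_scaleR)
  qed
  interpret N: kite_null_valuation \<nu>
  proof
    show "N.f x = 0" if "x > 0" for x
      using k1[OF that] k2[OF that] \<open>k2 \<noteq> 0\<close>
      by (simp add: N.f_def M.f_def m.f_def \<nu>_def k_def)
  qed
  have "\<forall>P\<in>polygons_o. \<mu> P = k *\<^sub>R moment_vector P"
    using N.mu_null by (simp add: \<nu>_def)
  then show ?thesis by blast
qed

end
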